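(* Let $\ell_0,\ell_2$ be coprime integers with $0<\ell_0<\ell_2$ and let $\varrho=\ell_0/\ell_2$. Along the $(\ell_0,\ell_2)$ family of spectral genus one constant mean curvature (cmc) tori of revolution in $\mathbb{S}^3$, the mean curvature decreases monotonically from $$H_0=\frac{1-2\varrho^2}{2\varrho\sqrt{1-\varrho^2}}$$ at the flat cmc torus to $H_s=\cot(\pi\varrho)$ at the sphere bouquet. This family contains exactly one minimal torus if $\varrho\in(\tfrac12,1/\sqrt2]$, and no minimal tori otherwise.
   Context: Equivariant cmc surfaces. Let $q\in[-1,1]\setminus\{0\}$ and let $\lambda_j=e^{2i\theta_j}$ ($j=1,2$) be two distinct points of $\mathbb{S}^1$ (sym points). Put $\varphi=\theta_1-\theta_2$, $k=\cos(\theta_1+\theta_2)$, $h=\cos(\theta_1-\theta_2)$, and let $v=\mathrm{dn}(y,1-q^2)$ (Jacobi function with parameter $1-q^2$). The associated equivariant cmc surface is the immersion $f:\mathbb{R}^2\to\mathbb{S}^3$, unique up to isometry, with induced metric $\sin^2\varphi\,v^2(dx^2+dy^2)$ and second fundamental form $H\sin^2\varphi\,v^2(dx^2+dy^2)+\mathrm{Re}\left(Q\,(dx+i\,dy)^2\right)$, with mean curvature $H=\cot\varphi$, up to the choice of normal ($|H|=|h|/\sqrt{1-h^2}$), and $Q=\frac{i}{2}q(\lambda_2^{-1}-\lambda_1^{-1})$. It is a surface of revolution iff $\lambda_2=\lambda_1^{-1}$, i.e. $k^2=1$. For $q=\pm1$ it is flat; for $0<|q|<1$ it has spectral genus one. Flow.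 With $K'=K(\sqrt{1-q^2})$, $E'=E(\sqrt{1-q^2})$ complete elliptic integrals (of modulus $\sqrt{1-q^2}$), families are integral curves of $\dot q=q(E'k-qK'h)$, $\dot k=\frac{1-k^2}{1-q^2}((1+q^2)E'-2q^2K')$, $\dot h=q\frac{1-h^2}{1-q^2}(2E'-(1+q^2)K')$. Along each family of tori of revolution ($k^2=1$), $|q|$ varies between $1$ (a flat cmc torus) and the limit $0$ (a sphere bouquet: a necklace of pairwise tangent round spheres with common rotation axis; the mean curvature "at the sphere bouquet" is the limit as $q\to0$). The $(\ell_0,\ell_2)$ family. For a flat torus at $q=\pm1$ with sym points $\lambda_1,\lambda_2$, put $\lambda_0=\mathrm{sign}(q)$, $m=(\lambda_0^{1/2},\lambda_1^{1/2},\lambda_2^{1/2})$, let $(s_0,s_1,s_2)$ be an integral real multiple of the real vector $i\,m\times\bar m$ with $\gcd(s_0,s_1+s_2,s_1-s_2)=2$, and set $(\ell_0,\ell_1,\ell_2)=\frac12(|s_0|,\min|s_1\pm s_2|,\max|s_1\pm s_2|)$; in the case of revolution $\ell_1=0$. The $(\ell_0,\ell_2)$ family is the family of tori of revolution on the integral curve ending at $|q|=1$ at the flat torus with triple $(\ell_0,0,\ell_2)$ (flat torus included). The sign of the mean curvature (choice of normal) is fixed so that the mean curvature of the flat cmc torus is positive for $\varrho\in(0,1/\sqrt2)$ and negative for $\varrho\in(1/\sqrt2,1)$. *)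

theory Defs
  imports "HOL-Analysis.Analysis"
begin

section \<open>Elliptic integrals and the Jacobi function dn\<close>

definition ellK :: "real \<Rightarrow> real" where  \<comment> \<open>argument: modulus\<close>
  "ellK \<kappa> = integral {0..pi/2} (\<lambda>t. 1 / sqrt (1 - \<kappa>\<^sup>2 * (sin t)\<^sup>2))"

definition ellE :: "real \<Rightarrow> real" where  \<comment> \<open>argument: modulus\<close>
  "ellE \<kappa> = integral {0..pi/2} (\<lambda>t. sqrt (1 - \<kappa>\<^sup>2 * (sin t)\<^sup>2))"

text \<open>For a parameter \<open>m < 1\<close> (the square of the modulus) the incomplete integral of the first
  kind is a bijection of the real line; its inverse is the Jacobi amplitude.\<close>

definition jacobi_am :: "real \<Rightarrow> real \<Rightarrow> real" where
  "jacobi_am y m = (THE u. (LBINT t=0..u. 1 / sqrt (1 - m * (sin t)\<^sup>2)) = y)"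

definition jacobi_dn :: "real \<Rightarrow> real \<Rightarrow> real" where
  "jacobi_dn y m = sqrt (1 - m * (sin (jacobi_am y m))\<^sup>2)"


section \<open>Immersed surfaces in the 3-sphere\<close>

text \<open>The 3-sphere is the unit sphere of \<^typ>\<open>real^4\<close>.  Below, \<open>dird u f p\<close> is the directional
  derivative of \<open>f\<close> at \<open>p\<close> along \<open>u\<close>.\<close>

definition dird :: "real \<times> real \<Rightarrow> (real \<times> real \<Rightarrow> real^4) \<Rightarrow> real \<times> real \<Rightarrow> real^4" where
  "dird u f p = frechet_derivative f (at p) u"

definition C2_map :: "(real \<times> real \<Rightarrow> real^4) \<Rightarrow> bool" where
  "C2_map f \<longleftrightarrow>
     (\<forall>p. f differentiable (at p)) \<and>
     (\<forall>u p. dird u f differentiable (at p)) \<and>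
     (\<forall>u w. continuous_on UNIV (dird w (dird u f)))"

definition immersion_S3 :: "(real \<times> real \<Rightarrow> real^4) \<Rightarrow> bool" where
  "immersion_S3 f \<longleftrightarrow>
     C2_map f \<and> range f \<subseteq> sphere 0 1 \<and> (\<forall>p. inj (frechet_derivative f (at p)))"

definition unit_normal :: "(real \<times> real \<Rightarrow> real^4) \<Rightarrow> (real \<times> real \<Rightarrow> real^4) \<Rightarrow> bool" where
  "unit_normal f N \<longleftrightarrow>
     continuous_on UNIV N \<and>
     (\<forall>p. norm (N p) = 1 \<and> N p \<bullet> f p = 0 \<and> (\<forall>u. N p \<bullet> dird u f p = 0))"

definition first_ff ::
    "(real \<times> real \<Rightarrow> real^4) \<Rightarrow> real \<times> real \<Rightarrow> real \<times> real \<Rightarrow> real \<times> real \<Rightarrow> real" where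
  "first_ff f p u w = dird u f p \<bullet> dird w f p"

text \<open>As \<open>N\<close> is orthogonal to \<open>f\<close>, the Levi-Civita connection of the 3-sphere may be replaced by
  the flat one of the ambient space here.\<close>

definition second_ff ::
    "(real \<times> real \<Rightarrow> real^4) \<Rightarrow> (real \<times> real \<Rightarrow> real^4) \<Rightarrow>
     real \<times> real \<Rightarrow> real \<times> real \<Rightarrow> real \<times> real \<Rightarrow> real" where
  "second_ff f N p u w = dird w (dird u f) p \<bullet> N p"

text \<open>Half the trace of the second fundamental form with respect to the first.\<close>

definition mean_curvature ::
    "(real \<times> real \<Rightarrow> real^4) \<Rightarrow> (real \<times> real \<Rightarrow> real^4) \<Rightarrow> real \<times> real \<Rightarrow> real" where
  "mean_curvature f N p =
     (let x = (1, 0); y = (0, 1); I = first_ff f p; II = second_ff f N p in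
      (II x x * I y y - 2 * II x y * I x y + II y y * I x x) /
      (2 * (I x x * I y y - (I x y)\<^sup>2)))"

definition torus :: "(real \<times> real \<Rightarrow> real^4) \<Rightarrow> bool" where
  "torus f \<longleftrightarrow>
     (\<exists>w1 w2. w1 \<noteq> w2 \<and> independent {w1, w2} \<and> (\<forall>p. f (p + w1) = f p \<and> f (p + w2) = f p))"

definition minimal_torus ::
    "(real \<times> real \<Rightarrow> real^4) \<Rightarrow> (real \<times> real \<Rightarrow> real^4) \<Rightarrow> bool" where
  "minimal_torus f N \<longleftrightarrow> torus f \<and> (\<forall>p. mean_curvature f N p = 0)"


section \<open>Equivariant cmc surfaces\<close>

text \<open>The sym points are \<open>\<lambda>\<^sub>j = exp (2 i \<theta>\<^sub>j)\<close>.\<close>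

definition sym_point :: "real \<Rightarrow> complex" where
  "sym_point \<theta> = cis (2 * \<theta>)"

definition hopf :: "real \<Rightarrow> real \<Rightarrow> real \<Rightarrow> complex" where
  "hopf q \<theta>1 \<theta>2 =
     \<i> / 2 * of_real q * (inverse (sym_point \<theta>2) - inverse (sym_point \<theta>1))"

text \<open>The quadratic forms \<open>dx\<^sup>2 + dy\<^sup>2\<close> and \<open>Re (Q (dx + i dy)\<^sup>2)\<close> are written as symmetric bilinear
  forms in \<open>u\<close>, \<open>w\<close>.\<close>

definition equivariant_cmc ::
    "real \<Rightarrow> real \<Rightarrow> real \<Rightarrow> (real \<times> real \<Rightarrow> real^4) \<Rightarrow> (real \<times> real \<Rightarrow> real^4) \<Rightarrow> bool" where
  "equivariant_cmc q \<theta>1 \<theta>2 f N \<longleftrightarrow>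
     q \<in> {-1..1} - {0} \<and> sym_point \<theta>1 \<noteq> sym_point \<theta>2 \<and>
     immersion_S3 f \<and> unit_normal f N \<and>
     (\<forall>x y u w. let g = (sin (\<theta>1 - \<theta>2))\<^sup>2 * (jacobi_dn y (1 - q\<^sup>2))\<^sup>2 * (u \<bullet> w) in
        first_ff f (x, y) u w = g \<and>
        second_ff f N (x, y) u w =
          cot (\<theta>1 - \<theta>2) * g
          + Re (hopf q \<theta>1 \<theta>2 * Complex (fst u) (snd u) * Complex (fst w) (snd w)))"


section \<open>The flow\<close>

text \<open>The right-hand sides for \<open>k\<close> and \<open>h\<close> have removable singularities at \<open>q\<^sup>2 = 1\<close>, where the
  continuous extensions vanish; this is also their value at \<open>q\<^sup>2 = 1\<close> under \<open>x / 0 = 0\<close>.\<close>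

definition flow_curve ::
    "real set \<Rightarrow> (real \<Rightarrow> real) \<Rightarrow> (real \<Rightarrow> real) \<Rightarrow> (real \<Rightarrow> real) \<Rightarrow> bool" where
  "flow_curve T q k h \<longleftrightarrow>
     (\<forall>t\<in>T. let K' = ellK (sqrt (1 - (q t)\<^sup>2)); E' = ellE (sqrt (1 - (q t)\<^sup>2)) in
        (q has_real_derivative q t * (E' * k t - q t * K' * h t)) (at t within T) \<and>
        (k has_real_derivative
           (1 - (k t)\<^sup>2) / (1 - (q t)\<^sup>2) * ((1 + (q t)\<^sup>2) * E' - 2 * (q t)\<^sup>2 * K')) (at t within T) \<and>
        (h has_real_derivative
           q t * ((1 - (h t)\<^sup>2) / (1 - (q t)\<^sup>2)) * (2 * E' - (1 + (q t)\<^sup>2) * K')) (at t within T))"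


section \<open>Flat tori and the families of tori of revolution\<close>

fun cross_complex :: "complex \<times> complex \<times> complex \<Rightarrow> complex \<times> complex \<times> complex
    \<Rightarrow> complex \<times> complex \<times> complex" where
  "cross_complex (a0, a1, a2) (b0, b1, b2) =
     (a1 * b2 - a2 * b1, a2 * b0 - a0 * b2, a0 * b1 - a1 * b0)"

text \<open>The square roots of \<open>\<lambda>\<^sub>1\<close>, \<open>\<lambda>\<^sub>2\<close> are \<open>exp (i \<theta>\<^sub>j)\<close>; other choices only change signs among the
  \<open>s\<^sub>j\<close> and do not affect the triple.\<close>

definition flat_triple ::
    "real \<Rightarrow> real \<Rightarrow> real \<Rightarrow> int \<times> int \<times> int \<Rightarrow> bool" where
  "flat_triple q \<theta>1 \<theta>2 l \<longleftrightarrow> \<bar>q\<bar> = 1 \<and>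
     (\<exists>s0 s1 s2 :: int. \<exists>r :: real.
        (let m0 = csqrt (of_real (sgn q)); m1 = cis \<theta>1; m2 = cis \<theta>2;
             (c0, c1, c2) = cross_complex (m0, m1, m2) (cnj m0, cnj m1, cnj m2)
         in of_int s0 = of_real r * (\<i> * c0) \<and>
            of_int s1 = of_real r * (\<i> * c1) \<and>
            of_int s2 = of_real r * (\<i> * c2)) \<and>
        gcd s0 (gcd (s1 + s2) (s1 - s2)) = 2 \<and>
        (case l of (l0, l1, l2) \<Rightarrow>
           2 * l0 = \<bar>s0\<bar> \<and>
           2 * l1 = min \<bar>s1 + s2\<bar> \<bar>s1 - s2\<bar> \<and>
           2 * l2 = max \<bar>s1 + s2\<bar> \<bar>s1 - s2\<bar>))"

text \<open>The \<open>(\<ell>\<^sub>0, \<ell>\<^sub>2)\<close> family, over the time interval \<open>T\<close> with the flat torus at \<open>t0\<close>.  Surfaces are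
  only determined up to isometry, so \<open>f t\<close> is any surface with the prescribed fundamental forms.
  The choice of normal is one global sign \<open>\<sigma>\<close>, fixed by the sign of the mean curvature of the flat
  torus.  The case of revolution is \<open>k\<^sup>2 = 1\<close>; the whole branch between the flat torus and the
  sphere bouquet is traversed, i.e. \<open>\<bar>q\<bar>\<close> takes all values in \<open>(0, 1]\<close>.\<close>

definition revolution_family ::
    "int \<Rightarrow> int \<Rightarrow> real set \<Rightarrow> real \<Rightarrow> (real \<Rightarrow> real) \<Rightarrow> (real \<Rightarrow> real) \<Rightarrow> (real \<Rightarrow> real) \<Rightarrow>
     (real \<Rightarrow> real \<times> real \<Rightarrow> real^4) \<Rightarrow> (real \<Rightarrow> real \<times> real \<Rightarrow> real^4) \<Rightarrow> bool" where
  "revolution_family l0 l2 T t0 q \<theta>1 \<theta>2 f N \<longleftrightarrow>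
     is_interval T \<and> t0 \<in> T \<and>
     continuous_on T \<theta>1 \<and> continuous_on T \<theta>2 \<and>
     flow_curve T q (\<lambda>t. cos (\<theta>1 t + \<theta>2 t)) (\<lambda>t. cos (\<theta>1 t - \<theta>2 t)) \<and>
     (\<forall>t\<in>T. (cos (\<theta>1 t + \<theta>2 t))\<^sup>2 = 1) \<and>
     flat_triple (q t0) (\<theta>1 t0) (\<theta>2 t0) (l0, 0, l2) \<and>
     (\<forall>t\<in>T - {t0}. 0 < \<bar>q t\<bar> \<and> \<bar>q t\<bar> < 1) \<and>
     (\<lambda>t. \<bar>q t\<bar>) ` T = {0<..1} \<and>
     (\<exists>\<sigma>\<in>{1, -1}. \<forall>t\<in>T. equivariant_cmc (q t) (\<theta>1 t) (\<theta>2 t) (f t) (\<lambda>p. \<sigma> *\<^sub>R N t p)) \<and>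
     (\<forall>t\<in>T. torus (f t)) \<and>
     (let \<rho> = real_of_int l0 / real_of_int l2 in
        \<forall>p. (0 < \<rho> \<and> \<rho> < 1 / sqrt 2 \<longrightarrow> mean_curvature (f t0) (N t0) p > 0) \<and>
            (1 / sqrt 2 < \<rho> \<and> \<rho> < 1 \<longrightarrow> mean_curvature (f t0) (N t0) p < 0))"

end

theory Submission
  imports Defs
begin

text \<open>
  On a family of revolution \<open>k\<close> is constantly \<open>\<plusminus>1\<close> and \<open>q\<close> has constant sign.  Put \<open>a = \<bar>q\<bar>\<close> and let
  \<open>b \<in> (0, \<pi>)\<close> be the angle with \<open>cos b = - sgn q k h\<close>; then the mean curvature is \<open>cot b\<close>.  With time
  running away from the flat torus the flow becomes \<open>a' = - a (E' + a K' cos b)\<close>, \<open>b' = a Q sin b\<close> with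
  \<open>Q = ((1 + a\<^sup>2) K' - 2 E') / (1 - a\<^sup>2) > 0\<close>, so \<open>b\<close> increases.  The function
  \<open>\<integral>\<^sub>0\<^sup>b (E' + a K' cos x) / sqrt (1 + a\<^sup>2 + 2 a cos x) dx\<close>
  is a first integral: its derivative in \<open>a\<close> is \<open>Q sin b / sqrt (1 + a\<^sup>2 + 2 a cos b)\<close>.  It equals
  \<open>\<pi> sin (b / 2) = \<pi> \<rho>\<close> at the flat torus \<open>a = 1\<close>, and it tends to \<open>b\<close> as \<open>a \<rightarrow> 0\<close>, where \<open>E' \<rightarrow> 1\<close> and
  \<open>a K' \<rightarrow> 0\<close>.  Hence \<open>b\<close> increases from \<open>2 arcsin \<rho>\<close> to \<open>\<pi> \<rho>\<close>, and the minimal tori are the solutions of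
  \<open>b = \<pi> / 2\<close>.
\<close>

section \<open>Complementary complete elliptic integrals\<close>

text \<open>With \<open>a = \<bar>q\<bar>\<close> this is the radicand at modulus
  \<open>sqrt (1 - a\<^sup>2)\<close>. As a sum of squares it makes sense for all real
  \<open>a\<close>, so the flat torus \<open>a = 1\<close> and the bouquet \<open>a = 0\<close> are
  interior points of its domain.\<close>

definition ell_rad :: "real \<Rightarrow> real \<Rightarrow> real" where
  "ell_rad a t = (cos t)\<^sup>2 + a\<^sup>2 * (sin t)\<^sup>2"

definition compl_K :: "real \<Rightarrow> real" where
  "compl_K a = integral {0..pi/2} (\<lambda>t. 1 / sqrt (ell_rad a t))"

definition compl_E :: "real \<Rightarrow> real" where
  "compl_E a = integral {0..pi/2} (\<lambda>t. sqrt (ell_rad a t))"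

text \<open>\<open>(K' - E') / (1 - a\<^sup>2)\<close> as an integral, which is regular at
  \<open>a = 1\<close>. It expresses the derivatives of both \<open>E'\<close> and
  \<open>a K'\<close>.\<close>

definition compl_M :: "real \<Rightarrow> real" where
  "compl_M a = integral {0..pi/2} (\<lambda>t. (sin t)\<^sup>2 / sqrt (ell_rad a t))"

text \<open>At \<open>a = 1\<close> division by zero gives 0, which is also the limit there.\<close>

definition compl_Q :: "real \<Rightarrow> real" where
  "compl_Q a = ((1 + a\<^sup>2) * compl_K a - 2 * compl_E a) / (1 - a\<^sup>2)"

lemma ell_rad_eq: "ell_rad a t = 1 - (1 - a\<^sup>2) * (sin t)\<^sup>2"
  by (simp add: ell_rad_def cos_squared_eq algebra_simps)

lemma ell_rad_pos [simp]: "a \<noteq> 0 \<Longrightarrow> 0 < ell_rad a t"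
proof (cases "sin t = 0")
  case True
  then show ?thesis by (simp add: ell_rad_def cos_squared_eq)
next
  case False
  assume "a \<noteq> 0"
  with False have "0 < a\<^sup>2 * (sin t)\<^sup>2" by simp
  then show ?thesis unfolding ell_rad_def by (intro add_nonneg_pos) auto
qed

lemma ell_rad_neq_0 [simp]: "a \<noteq> 0 \<Longrightarrow> ell_rad a t \<noteq> 0"
  using ell_rad_pos by (metis less_irrefl)

lemma ell_rad_nonneg [simp]: "0 \<le> ell_rad a t"
  by (simp add: ell_rad_def)

lemma ellE_eq_compl_E: assumes "q\<^sup>2 \<le> 1" shows "ellE (sqrt (1 - q\<^sup>2)) = compl_E \<bar>q\<bar>"
  using assms by (simp add: ellE_def compl_E_def ell_rad_eq)

lemma ellK_eq_compl_K: assumes "q\<^sup>2 \<le> 1" shows "ellK (sqrt (1 - q\<^sup>2)) = compl_K \<bar>q\<bar>"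
  using assms by (simp add: ellK_def compl_K_def ell_rad_eq)

lemma continuous_on_ell_rad [continuous_intros]:
  fixes f g :: "'a::t2_space \<Rightarrow> real"
  assumes "continuous_on S f" "continuous_on S g"
  shows "continuous_on S (\<lambda>x. ell_rad (f x) (g x))"
  unfolding ell_rad_def by (intro continuous_intros assms)

lemma compl_E_1: "compl_E 1 = pi / 2" and compl_K_1: "compl_K 1 = pi / 2"
  by (simp_all add: compl_E_def compl_K_def ell_rad_def)

lemma compl_K_minus_compl_E:
  assumes "a > 0"
  shows "compl_K a - compl_E a = (1 - a\<^sup>2) * compl_M a"
proof -
  have "compl_K a - compl_E a = integral {0..pi/2} (\<lambda>t. 1 / sqrt (ell_rad a t) - sqrt (ell_rad a t))"
    unfolding compl_K_def compl_E_def
    by (rule integral_diff [symmetric];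
        intro integrable_continuous_interval continuous_intros) (use assms in auto)
  also have "\<dots> = integral {0..pi/2} (\<lambda>t. (1 - a\<^sup>2) * ((sin t)\<^sup>2 / sqrt (ell_rad a t)))"
  proof (rule integral_cong)
    fix t
    have d: "ell_rad a t > 0" using assms by simp
    have "1 / sqrt (ell_rad a t) - sqrt (ell_rad a t) = (1 - ell_rad a t) / sqrt (ell_rad a t)"
      using d by (simp add: field_simps)
    then show "1 / sqrt (ell_rad a t) - sqrt (ell_rad a t) = (1 - a\<^sup>2) * ((sin t)\<^sup>2 / sqrt (ell_rad a t))"
      by (simp add: ell_rad_eq)
  qed
  finally show ?thesis by (simp only: compl_M_def integral_mult_right)
qed

section \<open>Derivatives of the complete integrals in \<open>a\<close>\<close>

text \<open>This primitive vanishes at 0 and at \<open>pi/2\<close>. Its derivative therefore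
  integrates to 0 and may be added to any integrand, which serves in place of integration by
  parts.\<close>

lemma ell_rad_primitive:
  assumes "a > 0"
  shows "((\<lambda>t. sin t * cos t / sqrt (ell_rad a t)) has_real_derivative
           ((cos t)^4 - a\<^sup>2 * (sin t)^4) / (ell_rad a t * sqrt (ell_rad a t))) (at t)"
proof -
  define d where "d = ell_rad a t"
  have d: "d > 0" using assms by (simp add: d_def)
  have dd: "((\<lambda>t. ell_rad a t) has_real_derivative - 2 * (1 - a\<^sup>2) * sin t * cos t) (at t)"
    unfolding ell_rad_def by (auto intro!: derivative_eq_intros simp: algebra_simps)
  have rd: "((\<lambda>t. sqrt (ell_rad a t)) has_real_derivative - (1 - a\<^sup>2) * sin t * cos t / sqrt d) (at t)"
    by (rule DERIV_chain2[OF DERIV_real_sqrt dd, THEN DERIV_cong]) (use d in \<open>simp_all add: d_def field_simps\<close>)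
  have "((\<lambda>t. sin t * cos t / sqrt (ell_rad a t)) has_real_derivative
      ((cos t * cos t + - sin t * sin t) * sqrt d - sin t * cos t * (- (1 - a\<^sup>2) * sin t * cos t / sqrt d)) / (sqrt d * sqrt d)) (at t)"
    by (rule DERIV_cong[OF DERIV_divide[OF DERIV_mult[OF DERIV_sin DERIV_cos] rd]])
       (use d in \<open>auto simp: d_def\<close>)
  moreover have "((cos t * cos t + - sin t * sin t) * sqrt d - sin t * cos t * (- (1 - a\<^sup>2) * sin t * cos t / sqrt d)) / (sqrt d * sqrt d)
     = (((cos t)\<^sup>2 - (sin t)\<^sup>2) * d + (1 - a\<^sup>2) * (sin t)\<^sup>2 * (cos t)\<^sup>2) / (d * sqrt d)"
  proof -
    \<comment> \<open>Naming the root \<open>r\<close> turns the claim into an identity of rational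
      functions.\<close>
    obtain r where r: "r > 0" "sqrt d = r" "d = r\<^sup>2"
      using d by (metis real_sqrt_gt_zero real_sqrt_pow2 less_imp_le)
    show ?thesis unfolding r(2) unfolding r(3) using r(1)
      by (simp add: field_simps power2_eq_square)
  qed
  moreover have "((cos t)\<^sup>2 - (sin t)\<^sup>2) * d + (1 - a\<^sup>2) * (sin t)\<^sup>2 * (cos t)\<^sup>2 = (cos t)^4 - a\<^sup>2 * (sin t)^4"
    by (simp add: d_def ell_rad_def algebra_simps power2_eq_square power4_eq_xxxx)
  ultimately show ?thesis by (simp add: d_def)
qed

lemma ell_rad_primitive_integral:
  assumes "a > 0"
  shows "((\<lambda>t. ((cos t)^4 - a\<^sup>2 * (sin t)^4) / (ell_rad a t * sqrt (ell_rad a t))) has_integral 0) {0..pi/2}"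
proof -
  have "((\<lambda>t. ((cos t)^4 - a\<^sup>2 * (sin t)^4) / (ell_rad a t * sqrt (ell_rad a t))) has_integral
     (sin (pi/2) * cos (pi/2) / sqrt (ell_rad a (pi/2)) - sin 0 * cos 0 / sqrt (ell_rad a 0))) {0..pi/2}"
    by (rule fundamental_theorem_of_calculus)
       (auto intro!: has_field_derivative_at_within ell_rad_primitive assms
             simp: has_real_derivative_iff_has_vector_derivative [symmetric])
  then show ?thesis by simp
qed

lemma compl_E_has_derivative:
  assumes "a > 0"
  shows "(compl_E has_real_derivative a * compl_M a) (at a)"
proof -
  have "((\<lambda>x. integral (cbox 0 (pi/2)) (\<lambda>t. sqrt (ell_rad x t))) has_real_derivative
         integral (cbox 0 (pi/2)) (\<lambda>t. a * ((sin t)\<^sup>2 / sqrt (ell_rad a t)))) (at a within {0<..})"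
  proof (rule leibniz_rule_field_derivative)
    fix x t :: real assume "x \<in> {0<..}"
    then have "ell_rad x t > 0" by simp
    then show "((\<lambda>x. sqrt (ell_rad x t)) has_real_derivative x * ((sin t)\<^sup>2 / sqrt (ell_rad x t))) (at x within {0<..})"
      unfolding ell_rad_def by (auto intro!: derivative_eq_intros simp: field_simps)
  next
    show "(\<lambda>t. sqrt (ell_rad x t)) integrable_on cbox 0 (pi/2)" for x
      by (intro integrable_continuous continuous_intros)
  next
    show "continuous_on ({0<..} \<times> cbox 0 (pi/2)) (\<lambda>(x, t). x * ((sin t)\<^sup>2 / sqrt (ell_rad x t)))"
      unfolding split_beta
      by (intro continuous_intros) auto
  qed (use assms in auto)
  then show ?thesis
    using assms by (simp only: at_within_open[OF _ open_greaterThan] compl_E_def[abs_def] compl_M_def integral_mult_right cbox_interval greaterThan_iff)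
qed

text \<open>The product \<open>a K'\<close> is the combination that occurs in the flow.
  Differentiation under the integral sign gives \<open>(cos t)\<^sup>2 / d\<close> with
  \<open>d\<close> the 3/2 power of the radicand; this differs from the integrand of
  \<open>compl_M\<close> by exactly the null integrand above.\<close>

lemma mult_compl_K_has_derivative:
  assumes "a > 0"
  shows "((\<lambda>a. a * compl_K a) has_real_derivative compl_M a) (at a)"
proof -
  have "((\<lambda>x. integral (cbox 0 (pi/2)) (\<lambda>t. x / sqrt (ell_rad x t))) has_real_derivative
         integral (cbox 0 (pi/2)) (\<lambda>t. (cos t)\<^sup>2 / (ell_rad a t * sqrt (ell_rad a t)))) (at a within {0<..})"
  proof (rule leibniz_rule_field_derivative)
    fix x t :: real assume "x \<in> {0<..}"
    then have d: "ell_rad x t > 0" by simp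
    have rd: "((\<lambda>x. sqrt (ell_rad x t)) has_real_derivative x * (sin t)\<^sup>2 / sqrt (ell_rad x t)) (at x within {0<..})"
      using d unfolding ell_rad_def by (auto intro!: derivative_eq_intros simp: field_simps)
    have "((\<lambda>x. x / sqrt (ell_rad x t)) has_real_derivative
        (1 * sqrt (ell_rad x t) - x * (x * (sin t)\<^sup>2 / sqrt (ell_rad x t))) / (sqrt (ell_rad x t) * sqrt (ell_rad x t)))
        (at x within {0<..})"
      using d by (intro DERIV_divide rd DERIV_ident) auto
    moreover have "(1 * sqrt (ell_rad x t) - x * (x * (sin t)\<^sup>2 / sqrt (ell_rad x t))) / (sqrt (ell_rad x t) * sqrt (ell_rad x t))
       = (ell_rad x t - x\<^sup>2 * (sin t)\<^sup>2) / (ell_rad x t * sqrt (ell_rad x t))"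
      using d by (simp add: field_simps power2_eq_square)
    ultimately show "((\<lambda>x. x / sqrt (ell_rad x t)) has_real_derivative
        (cos t)\<^sup>2 / (ell_rad x t * sqrt (ell_rad x t))) (at x within {0<..})"
      by (simp add: ell_rad_def)
  next
    show "(\<lambda>t. x / sqrt (ell_rad x t)) integrable_on cbox 0 (pi/2)" if "x \<in> {0<..}" for x
      using that by (intro integrable_continuous continuous_intros) auto
  next
    show "continuous_on ({0<..} \<times> cbox 0 (pi/2)) (\<lambda>(x, t). (cos t)\<^sup>2 / (ell_rad x t * sqrt (ell_rad x t)))"
      unfolding split_beta
      by (intro continuous_intros) auto
  qed (use assms in auto)
  moreover have "integral {0..pi/2} (\<lambda>t. (cos t)\<^sup>2 / (ell_rad a t * sqrt (ell_rad a t))) = compl_M a"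
  proof -
    have "((\<lambda>t. (sin t)\<^sup>2 / sqrt (ell_rad a t)) has_integral compl_M a) {0..pi/2}"
      unfolding compl_M_def
      by (intro integrable_integral integrable_continuous_interval continuous_intros)
         (use assms in auto)
    from has_integral_add[OF this ell_rad_primitive_integral[OF assms]]
    have "((\<lambda>t. (sin t)\<^sup>2 / sqrt (ell_rad a t) + ((cos t)^4 - a\<^sup>2 * (sin t)^4) / (ell_rad a t * sqrt (ell_rad a t)))
        has_integral compl_M a) {0..pi/2}" by simp
    moreover have "(sin t)\<^sup>2 / sqrt (ell_rad a t) + ((cos t)^4 - a\<^sup>2 * (sin t)^4) / (ell_rad a t * sqrt (ell_rad a t))
        = (cos t)\<^sup>2 / (ell_rad a t * sqrt (ell_rad a t))" for t
    proof -
      have d: "ell_rad a t > 0" using assms by simp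
      have "(sin t)\<^sup>2 * ell_rad a t + ((cos t)^4 - a\<^sup>2 * (sin t)^4) = (cos t)\<^sup>2 * ((sin t)\<^sup>2 + (cos t)\<^sup>2)"
        unfolding ell_rad_def by algebra
      moreover have "(sin t)\<^sup>2 / sqrt (ell_rad a t) = (sin t)\<^sup>2 * ell_rad a t / (ell_rad a t * sqrt (ell_rad a t))"
        using d by (simp del: times_divide_eq_left)
      ultimately show ?thesis
        by (simp only: add_divide_distrib [symmetric] sin_cos_squared_add mult_1_right)
    qed
    ultimately show ?thesis by (simp add: integral_unique)
  qed
  ultimately show ?thesis
    using assms by (simp add: at_within_open[OF _ open_greaterThan] compl_K_def[abs_def] flip: integral_mult_right)
qed

text \<open>The integrand obtained from the definition is
  \<open>((sin t)\<^sup>2 - (cos t)\<^sup>2) / sqrt (ell_rad a t)\<close>, which changes sign.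
  Adding the null integrand turns it into the nonnegative \<open>?g\<close>.\<close>

lemma compl_Q_pos:
  assumes "0 < a" "a < 1"
  shows "compl_Q a > 0"
proof -
  have a1: "1 - a\<^sup>2 > 0" using assms by (simp add: power_less_one_iff)
  let ?g = "\<lambda>t. (1 - a\<^sup>2) * ((sin t)\<^sup>2 * (cos t)\<^sup>2 / (ell_rad a t * sqrt (ell_rad a t)))"
  have "((\<lambda>t. (1 + a\<^sup>2) * (1 / sqrt (ell_rad a t)) - 2 * sqrt (ell_rad a t)) has_integral
      (1 + a\<^sup>2) * compl_K a - 2 * compl_E a) {0..pi/2}"
    unfolding compl_K_def compl_E_def
    by (intro has_integral_diff has_integral_mult_right integrable_integral
        integrable_continuous_interval continuous_intros)
      (use assms in auto)
  from has_integral_add[OF has_integral_mult_right[OF this, of "1 / (1 - a\<^sup>2)"]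
      ell_rad_primitive_integral[OF assms(1)]]
  have "((\<lambda>t. 1 / (1 - a\<^sup>2) * ((1 + a\<^sup>2) * (1 / sqrt (ell_rad a t)) - 2 * sqrt (ell_rad a t)) +
       ((cos t)^4 - a\<^sup>2 * (sin t)^4) / (ell_rad a t * sqrt (ell_rad a t))) has_integral compl_Q a) {0..pi/2}"
    by (simp add: compl_Q_def)
  moreover have "1 / (1 - a\<^sup>2) * ((1 + a\<^sup>2) * (1 / sqrt (ell_rad a t)) - 2 * sqrt (ell_rad a t)) +
       ((cos t)^4 - a\<^sup>2 * (sin t)^4) / (ell_rad a t * sqrt (ell_rad a t)) = ?g t" for t
  proof -
    have d: "ell_rad a t > 0" using assms by simp
    have c: "(cos t)\<^sup>2 = 1 - (sin t)\<^sup>2" by (simp add: cos_squared_eq)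
    have "(1 + a\<^sup>2) - 2 * ell_rad a t = (1 - a\<^sup>2) * ((sin t)\<^sup>2 - (cos t)\<^sup>2)"
      unfolding ell_rad_def c by algebra
    moreover have "(1 + a\<^sup>2) * (1 / sqrt (ell_rad a t)) - 2 * sqrt (ell_rad a t)
       = ((1 + a\<^sup>2) - 2 * ell_rad a t) / sqrt (ell_rad a t)"
      using d by (simp add: field_simps)
    ultimately have "1 / (1 - a\<^sup>2) * ((1 + a\<^sup>2) * (1 / sqrt (ell_rad a t)) - 2 * sqrt (ell_rad a t))
       = ((sin t)\<^sup>2 - (cos t)\<^sup>2) / sqrt (ell_rad a t)"
      using a1 by simp
    also have "\<dots> = ((sin t)\<^sup>2 - (cos t)\<^sup>2) * ell_rad a t / (ell_rad a t * sqrt (ell_rad a t))"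
      using d by simp
    finally have *: "1 / (1 - a\<^sup>2) * ((1 + a\<^sup>2) * (1 / sqrt (ell_rad a t)) - 2 * sqrt (ell_rad a t))
       = ((sin t)\<^sup>2 - (cos t)\<^sup>2) * ell_rad a t / (ell_rad a t * sqrt (ell_rad a t))" .
    have "((sin t)\<^sup>2 - (cos t)\<^sup>2) * ell_rad a t + ((cos t)^4 - a\<^sup>2 * (sin t)^4)
       = (1 - a\<^sup>2) * ((sin t)\<^sup>2 * (cos t)\<^sup>2)"
      unfolding ell_rad_def by algebra
    then show ?thesis
      by (simp only: * add_divide_distrib [symmetric] times_divide_eq_right [of "1 - a\<^sup>2"])
  qed
  ultimately have g: "(?g has_integral compl_Q a) (cbox 0 (pi/2))" by simp
  have cont: "continuous_on (cbox 0 (pi/2)) ?g"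
    by (intro continuous_intros) (use assms in auto)
  have nonneg: "?g t \<ge> 0" for t
    using a1 assms by (intro mult_nonneg_nonneg divide_nonneg_nonneg) auto
  have "compl_Q a \<ge> 0" using has_integral_nonneg[OF g] nonneg by auto
  \<comment> \<open>Strictness: a continuous nonnegative integrand with integral 0 vanishes
    identically, but at \<open>pi/4\<close> this one is positive.\<close>
  moreover have "compl_Q a \<noteq> 0"
  proof
    assume "compl_Q a = 0"
    with has_integral_0_cbox_imp_0[OF cont nonneg, of "pi/4"] g have "?g (pi/4) = 0"
      using pi_gt_zero by (simp add: box_real del: pi_gt_zero mult_eq_0_iff divide_eq_0_iff)
    moreover have "?g (pi/4) > 0"
      using a1 assms by (intro mult_pos_pos divide_pos_pos) (auto simp: sin_45 cos_45)
    ultimately show False by (simp only: less_irrefl)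
  qed
  ultimately show ?thesis by simp
qed

section \<open>Limits at the sphere bouquet, and continuity\<close>

text \<open>The square root is continuous at 0 too, so the integral is continuous across
  \<open>a = 0\<close>, where the integrand becomes \<open>cos\<close>.\<close>

lemma compl_E_tendsto_1: "(compl_E \<longlongrightarrow> 1) (at_right 0)"
proof -
  have "continuous_on UNIV (\<lambda>x. integral (cbox 0 (pi/2)) (\<lambda>t. sqrt (ell_rad x t)))"
    by (intro integral_continuous_on_param) (auto simp: split_beta intro!: continuous_intros)
  then have "isCont compl_E 0"
    by (simp add: continuous_on_eq_continuous_at compl_E_def[abs_def])
  then have "(compl_E \<longlongrightarrow> compl_E 0) (at_right 0)"
    by (auto simp: isCont_def intro: tendsto_within_subset)
  moreover have "compl_E 0 = 1"
  proof -
    have "compl_E 0 = integral {0..pi/2} cos"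
      unfolding compl_E_def
      by (rule integral_cong) (auto simp: ell_rad_def intro!: abs_of_nonneg cos_ge_zero)
    also have "(cos has_integral (sin (pi/2) - sin 0)) {0..pi/2}"
      by (rule fundamental_theorem_of_calculus)
         (auto intro!: derivative_eq_intros simp: has_real_derivative_iff_has_vector_derivative [symmetric])
    then have "integral {0..pi/2} cos = (1::real)" by (simp add: integral_unique)
    finally show ?thesis .
  qed
  ultimately show ?thesis by simp
qed

text \<open>\<open>compl_K\<close> itself diverges at 0. For \<open>a < 1\<close> the radicand is at
  least \<open>a\<^sup>2\<close>, so \<open>a\<close> times the integrand is bounded by 1, and
  dominated convergence applies along sequences.\<close>

lemma mult_compl_K_tendsto_0: "((\<lambda>a. a * compl_K a) \<longlongrightarrow> 0) (at_right 0)"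
proof (rule tendsto_at_right_sequentially[of 0 1])
  fix a :: "nat \<Rightarrow> real"
  assume a: "\<And>n. 0 < a n" "a \<longlonglongrightarrow> 0" "\<And>n. a n < 1"
  let ?f = "\<lambda>n t. a n / sqrt (ell_rad (a n) t)"
  \<comment> \<open>At \<open>pi/2\<close> the radicand is \<open>a\<^sup>2\<close>, so the quotient
    stays 1 there; this single point does not affect the integral.\<close>
  let ?g = "\<lambda>t. if t = pi/2 then 1 else 0 :: real"
  have a0: "a n \<noteq> 0" for n using a(1)[of n] by simp
  have "(\<lambda>n. integral {0..pi/2} (?f n)) \<longlonglongrightarrow> integral {0..pi/2} ?g"
  proof (rule dominated_convergence(2)[where h = "\<lambda>_. 1"])
    show "?f n integrable_on {0..pi/2}" for n
      by (intro integrable_continuous_interval continuous_intros) (use a0 in auto)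
  next
    fix n and t :: real
    have "(a n)\<^sup>2 \<le> ell_rad (a n) t"
    proof -
      have "(a n)\<^sup>2 * (cos t)\<^sup>2 \<le> 1 * (cos t)\<^sup>2"
        using a(1)[of n] a(3)[of n] by (intro mult_right_mono) (auto simp: power_le_one_iff less_imp_le)
      then show ?thesis by (simp add: ell_rad_def sin_squared_eq algebra_simps)
    qed
    then have "a n \<le> sqrt (ell_rad (a n) t)" by (rule real_le_rsqrt)
    then show "norm (?f n t) \<le> 1" using a(1)[of n] by (simp add: divide_le_eq)
  next
    fix t :: real assume t: "t \<in> {0..pi/2}"
    show "(\<lambda>n. ?f n t) \<longlonglongrightarrow> ?g t"
    proof (cases "t = pi/2")
      case True
      have "?f n t = 1" for n using a(1)[of n] unfolding True ell_rad_def by simp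
      with True show ?thesis by (simp only: if_True refl tendsto_const)
    next
      case False
      with t have c: "cos t > 0" by (intro cos_gt_zero_pi) auto
      have "(\<lambda>n. ?f n t) \<longlonglongrightarrow> 0 / sqrt (ell_rad 0 t)"
        unfolding ell_rad_def using c
        by (intro tendsto_intros a) auto
      with False show ?thesis by simp
    qed
  qed auto
  moreover have "integral {0..pi/2} ?g = 0"
    using integral_spike[of "{pi/2}" "{0..pi/2}" ?g "\<lambda>_. 0"] by simp
  moreover have "integral {0..pi/2} (?f n) = a n * compl_K (a n)" for n
    using integral_mult_right[of "{0..pi/2}" "a n" "\<lambda>t. 1 / sqrt (ell_rad (a n) t)"] by (simp add: compl_K_def)
  ultimately show "(\<lambda>n. a n * compl_K (a n)) \<longlonglongrightarrow> 0" by simp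
qed simp

lemma continuous_on_compl_E [continuous_intros]:
  fixes f :: "'a::topological_space \<Rightarrow> real"
  assumes "continuous_on S f" "\<And>x. x \<in> S \<Longrightarrow> 0 < f x"
  shows "continuous_on S (\<lambda>x. compl_E (f x))"
proof (rule continuous_on_compose2[of "{0<..}" compl_E])
  show "continuous_on {0<..} compl_E"
    by (auto intro!: continuous_at_imp_continuous_on DERIV_isCont compl_E_has_derivative)
qed (use assms in auto)

lemma continuous_on_compl_K [continuous_intros]:
  fixes f :: "'a::topological_space \<Rightarrow> real"
  assumes "continuous_on S f" "\<And>x. x \<in> S \<Longrightarrow> 0 < f x"
  shows "continuous_on S (\<lambda>x. compl_K (f x))"
proof (rule continuous_on_compose2[of "{0<..}" compl_K])
  \<comment> \<open>Continuity is known for the differentiable product \<open>a * compl_K a\<close>,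
    hence the division by \<open>a\<close>.\<close>
  have "continuous_on {0<..} (\<lambda>a. (a * compl_K a) / a)"
    by (intro continuous_on_divide continuous_on_id)
       (auto intro!: continuous_at_imp_continuous_on DERIV_isCont mult_compl_K_has_derivative)
  then show "continuous_on {0<..} compl_K"
    by (rule continuous_on_eq) auto
qed (use assms in auto)

lemma continuous_on_compl_Q [continuous_intros]:
  fixes f :: "'a::topological_space \<Rightarrow> real"
  assumes "continuous_on S f" "\<And>x. x \<in> S \<Longrightarrow> 0 < f x \<and> f x < 1"
  shows "continuous_on S (\<lambda>x. compl_Q (f x))"
proof -
  have "1 - (f x)\<^sup>2 \<noteq> 0" if "x \<in> S" for x
    using assms(2)[OF that] by (simp add: power2_eq_1_iff)
  then show ?thesis unfolding compl_Q_def by (intro continuous_intros assms) (use assms in auto)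
qed

section \<open>The density of the first integral\<close>

text \<open>The squared modulus of \<open>1 + a * cis b\<close>.\<close>

definition chord_sq :: "real \<Rightarrow> real \<Rightarrow> real" where
  "chord_sq a b = 1 + a\<^sup>2 + 2 * a * cos b"

definition period_den :: "real \<Rightarrow> real \<Rightarrow> real" where
  "period_den a b = (compl_E a + a * compl_K a * cos b) / sqrt (chord_sq a b)"

text \<open>This and \<open>period_den_b\<close> are the partial derivatives of
  \<open>period_den\<close>. The first one turns out to be a multiple of
  \<open>compl_Q\<close>.\<close>

definition period_den_a :: "real \<Rightarrow> real \<Rightarrow> real" where
  "period_den_a a b = compl_Q a * (a + cos b) * (1 + a * cos b) / (chord_sq a b * sqrt (chord_sq a b))"

definition period_den_b :: "real \<Rightarrow> real \<Rightarrow> real" where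
  "period_den_b a b = ((compl_E a + a * compl_K a * cos b) * a * sin b - a * compl_K a * sin b * chord_sq a b)
      / (chord_sq a b * sqrt (chord_sq a b))"

text \<open>On the closed rectangle the modulus vanishes only at \<open>a = 1\<close>,
  \<open>b = pi\<close>; this is why \<open>b\<close> is kept strictly below
  \<open>pi\<close>.\<close>

lemma chord_sq_pos:
  assumes "0 < a" "a \<le> 1" "0 \<le> b" "b < pi"
  shows "0 < chord_sq a b"
proof -
  have "cos b > -1" using cos_monotone_0_pi[of b pi] assms by simp
  then have "2 * a * (1 + cos b) > 0" using assms by simp
  moreover have "chord_sq a b = (1 - a)\<^sup>2 + 2 * a * (1 + cos b)"
    by (simp add: chord_sq_def power2_eq_square algebra_simps)
  ultimately show ?thesis by (simp add: add_nonneg_pos)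
qed

lemma continuous_on_chord_sq [continuous_intros]:
  fixes f g :: "'a::t2_space \<Rightarrow> real"
  assumes "continuous_on S f" "continuous_on S g"
  shows "continuous_on S (\<lambda>x. chord_sq (f x) (g x))"
  unfolding chord_sq_def by (intro continuous_intros assms)

lemma continuous_on_period_den:
  fixes f g :: "'a::t2_space \<Rightarrow> real"
  assumes "continuous_on S f" "continuous_on S g"
    and "\<And>x. x \<in> S \<Longrightarrow> 0 < f x \<and> f x \<le> 1 \<and> 0 \<le> g x \<and> g x < pi"
  shows "continuous_on S (\<lambda>x. period_den (f x) (g x))"
proof -
  have "chord_sq (f x) (g x) \<noteq> 0" if "x \<in> S" for x
    using chord_sq_pos[of "f x" "g x"] assms(3)[OF that] by auto
  then show ?thesis
    unfolding period_den_def by (intro continuous_intros assms) (use assms(3) in auto)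
qed

lemma continuous_on_period_den_ab:
  fixes f g :: "'a::t2_space \<Rightarrow> real"
  assumes "continuous_on S f" "continuous_on S g"
    and "\<And>x. x \<in> S \<Longrightarrow> 0 < f x \<and> f x < 1 \<and> 0 \<le> g x \<and> g x < pi"
  shows "continuous_on S (\<lambda>x. period_den_a (f x) (g x))" "continuous_on S (\<lambda>x. period_den_b (f x) (g x))"
proof -
  have "chord_sq (f x) (g x) \<noteq> 0" if "x \<in> S" for x
    using chord_sq_pos[of "f x" "g x"] assms(3)[OF that] by auto
  then show "continuous_on S (\<lambda>x. period_den_a (f x) (g x))" "continuous_on S (\<lambda>x. period_den_b (f x) (g x))"
    unfolding period_den_a_def period_den_b_def
    by (intro continuous_intros assms; use assms(3) in auto)+
qed

text \<open>Stated along a curve, it covers the derivative along the flow and, for constant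
  \<open>a\<close>, the derivative in the variable of integration.\<close>

lemma period_den_has_derivative:
  assumes a: "(a has_real_derivative a') (at u)" and b: "(b has_real_derivative b') (at u)"
    and rng: "0 < a u" "a u < 1" "0 \<le> b u" "b u < pi"
  shows "((\<lambda>u. period_den (a u) (b u)) has_real_derivative
           a' * period_den_a (a u) (b u) + b' * period_den_b (a u) (b u)) (at u)"
proof -
  define A C E K M Q w where defs: "A = a u" "C = cos (b u)" "E = compl_E A" "K = compl_K A" "M = compl_M A" "Q = compl_Q A"
     "w = chord_sq (a u) (b u)"
  have w: "w > 0" using chord_sq_pos rng by (simp add: defs)
  have A: "A > 0" "1 - A\<^sup>2 \<noteq> 0" using rng by (auto simp: defs power2_eq_1_iff)
  \<comment> \<open>\<open>E\<close>, \<open>K\<close>, \<open>M\<close>, \<open>Q\<close> satisfy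
    two independent linear relations, so \<open>E\<close> and \<open>K\<close> can be expressed by
    \<open>M\<close> and \<open>Q\<close>.\<close>
  have KM: "K - E = (1 - A\<^sup>2) * M" using compl_K_minus_compl_E[OF A(1)] by (simp add: defs)
  have QM: "Q * (1 - A\<^sup>2) = (1 + A\<^sup>2) * K - 2 * E" using A(2) by (simp add: defs compl_Q_def)
  have Q: "M * (1 + A\<^sup>2) - E = Q"
  proof -
    have "(1 - A\<^sup>2) * (M * (1 + A\<^sup>2) - E) = (1 - A\<^sup>2) * Q"
      using KM QM by algebra
    with A(2) show ?thesis by simp
  qed
  have Q2: "2 * M - K = Q"
  proof -
    have "(1 - A\<^sup>2) * (2 * M - K) = (1 - A\<^sup>2) * Q"
      using KM QM by algebra
    with A(2) show ?thesis by simp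
  qed
  have dE: "((\<lambda>u. compl_E (a u)) has_real_derivative A * M * a') (at u)"
    using DERIV_chain2[OF compl_E_has_derivative a] A by (simp add: defs)
  have dK: "((\<lambda>u. a u * compl_K (a u)) has_real_derivative M * a') (at u)"
    using DERIV_chain2[OF mult_compl_K_has_derivative a] A by (simp add: defs)
  have dC: "((\<lambda>u. cos (b u)) has_real_derivative - sin (b u) * b') (at u)"
    by (rule DERIV_fun_cos[OF b])
  have dw: "((\<lambda>u. chord_sq (a u) (b u)) has_real_derivative
        2 * A * a' + 2 * (a' * C) - 2 * A * (sin (b u) * b')) (at u)"
    unfolding chord_sq_def using a b
    by (auto intro!: derivative_eq_intros simp: defs algebra_simps)
  have dr: "((\<lambda>u. sqrt (chord_sq (a u) (b u))) has_real_derivative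
        (A * a' + a' * C - A * (sin (b u) * b')) / sqrt w) (at u)"
    by (rule DERIV_cong[OF DERIV_chain2[OF DERIV_real_sqrt dw]])
       (use w in \<open>simp_all add: defs field_simps\<close>)
  have dn: "((\<lambda>u. compl_E (a u) + a u * compl_K (a u) * cos (b u)) has_real_derivative
       A * M * a' + (M * a' * C + (- sin (b u) * b') * (A * K))) (at u)"
    using DERIV_add[OF dE DERIV_mult[OF dK dC]] by (simp add: defs)
  have "((\<lambda>u. period_den (a u) (b u)) has_real_derivative
     ((A * M * a' + (M * a' * C + (- sin (b u) * b') * (A * K))) * sqrt w
       - (E + A * K * C) * ((A * a' + a' * C - A * (sin (b u) * b')) / sqrt w)) / (sqrt w * sqrt w)) (at u)"
    using DERIV_divide[OF dn dr] w by (simp add: defs period_den_def)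
  moreover have "((A * M * a' + (M * a' * C + (- sin (b u) * b') * (A * K))) * sqrt w
       - (E + A * K * C) * ((A * a' + a' * C - A * (sin (b u) * b')) / sqrt w)) / (sqrt w * sqrt w)
     = ((A * M * a' + (M * a' * C + (- sin (b u) * b') * (A * K))) * w
       - (E + A * K * C) * (A * a' + a' * C - A * (sin (b u) * b'))) / (w * sqrt w)" (is "_ = ?n / _")
    using w by (simp add: field_simps)
  \<comment> \<open>Once \<open>E\<close> and \<open>K\<close> are eliminated, the terms with
    \<open>M\<close> cancel in the coefficient of \<open>a'\<close>, which leaves the factor
    \<open>Q\<close>.\<close>
  moreover have "?n = a' * (Q * (A + C) * (1 + A * C)) + b' * ((E + A * K * C) * A * sin (b u) - A * K * sin (b u) * w)"
  proof -
    have "w = 1 + A\<^sup>2 + 2 * A * C" by (simp add: defs chord_sq_def)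
    moreover have "E = M * (1 + A\<^sup>2) - Q" "K = 2 * M - Q" using Q Q2 by auto
    ultimately show ?thesis by (simp only:) (simp add: algebra_simps power2_eq_square)
  qed
  ultimately show ?thesis
    by (simp add: defs period_den_a_def period_den_b_def add_divide_distrib)
qed

text \<open>The reason why the integral of \<open>period_den\<close> is conserved: its
  \<open>a\<close>-derivative is again a derivative in \<open>b\<close>, of a function that vanishes
  at \<open>b = 0\<close>. The numerators match by \<open>cos b * chord_sq a b + a * (sin b)\<^sup>2
  = (a + cos b) * (1 + a * cos b)\<close>.\<close>

lemma period_den_primitive:
  assumes "0 < a" "a \<le> 1" "0 \<le> b" "b < pi"
  shows "((\<lambda>b. compl_Q a * sin b / sqrt (chord_sq a b)) has_real_derivative period_den_a a b) (at b)"
proof -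
  define w where "w = chord_sq a b"
  have w: "w > 0" using chord_sq_pos assms by (simp add: w_def)
  have dw: "((\<lambda>b. chord_sq a b) has_real_derivative - 2 * a * sin b) (at b)"
    unfolding chord_sq_def by (auto intro!: derivative_eq_intros)
  have dr: "((\<lambda>b. sqrt (chord_sq a b)) has_real_derivative - a * sin b / sqrt w) (at b)"
    by (rule DERIV_cong[OF DERIV_chain2[OF DERIV_real_sqrt dw]])
       (use w in \<open>simp_all add: w_def field_simps\<close>)
  have "((\<lambda>b. compl_Q a * sin b / sqrt (chord_sq a b)) has_real_derivative
     (compl_Q a * cos b * sqrt w - compl_Q a * sin b * (- a * sin b / sqrt w)) / (sqrt w * sqrt w)) (at b)"
    using DERIV_divide[OF DERIV_cmult[OF DERIV_sin] dr] w by (simp add: w_def)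
  moreover have "(compl_Q a * cos b * sqrt w - compl_Q a * sin b * (- a * sin b / sqrt w)) / (sqrt w * sqrt w)
      = (compl_Q a * cos b * w + compl_Q a * a * (sin b)\<^sup>2) / (w * sqrt w)"
    using w by (simp add: field_simps power2_eq_square)
  moreover have "compl_Q a * cos b * w + compl_Q a * a * (sin b)\<^sup>2 = compl_Q a * (a + cos b) * (1 + a * cos b)"
    unfolding w_def chord_sq_def sin_squared_eq by algebra
  ultimately show ?thesis by (simp add: w_def period_den_a_def)
qed

section \<open>The reduced flow\<close>

text \<open>\<open>u\<close> is the time elapsed since the flat torus at \<open>u = 0\<close>. That
  \<open>S\<close> lies to the right of 0 is a consequence, proved in \<open>S_nonneg\<close>,
  rather than an assumption.\<close>

locale revolution_flow =
  fixes S :: "real set" and a b :: "real \<Rightarrow> real"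
  assumes S: "is_interval S" "0 \<in> S"
    and a_image: "a ` S = {0<..1}"
    and a_eq_1: "\<And>u. u \<in> S \<Longrightarrow> a u = 1 \<longleftrightarrow> u = 0"
    and b_rng: "\<And>u. u \<in> S \<Longrightarrow> 0 < b u \<and> b u < pi"
    and a_deriv: "\<And>u. u \<in> S \<Longrightarrow>
        (a has_real_derivative - (a u * (compl_E (a u) + a u * compl_K (a u) * cos (b u)))) (at u within S)"
    and b_deriv: "\<And>u. u \<in> S \<Longrightarrow>
        (b has_real_derivative a u * sin (b u) * compl_Q (a u)) (at u within S)"
begin

lemma a_rng: "u \<in> S \<Longrightarrow> 0 < a u \<and> a u \<le> 1"
  using a_image by auto

text \<open>At the flat torus \<open>a' = - pi / 2 * (1 + cos b) < 0\<close>, so times just before 0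
  would give \<open>a > 1\<close>.\<close>

lemma S_nonneg: "u \<in> S \<Longrightarrow> 0 \<le> u"
proof (rule ccontr)
  assume u: "u \<in> S" "\<not> 0 \<le> u"
  have "cos (b 0) > -1" using cos_monotone_0_pi[of "b 0" pi] b_rng[OF S(2)] by simp
  then have "pi / 2 * (1 + cos (b 0)) > 0" by simp
  then have "- (a 0 * (compl_E (a 0) + a 0 * compl_K (a 0) * cos (b 0))) < 0"
    using a_eq_1[OF S(2)] by (simp add: compl_E_1 compl_K_1 algebra_simps)
  from has_real_derivative_neg_dec_left[OF a_deriv[OF S(2)] this]
  obtain d where d: "d > 0" "\<And>h. h > 0 \<Longrightarrow> 0 - h \<in> S \<Longrightarrow> h < d \<Longrightarrow> a 0 < a (0 - h)" by blast
  define h where "h = min (d / 2) (- u)"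
  have "h > 0" "h < d" using d u by (auto simp: h_def)
  moreover have "- h \<in> S"
    using mem_is_interval_1_I[OF S(1) u(1) S(2), of "-h"] \<open>h > 0\<close> by (simp add: h_def)
  ultimately have "a 0 < a (- h)" using d(2)[of h] by simp
  with a_eq_1[OF S(2)] a_rng[OF \<open>- h \<in> S\<close>] show False by simp
qed

lemma between: "u \<in> S \<Longrightarrow> 0 \<le> x \<Longrightarrow> x \<le> u \<Longrightarrow> x \<in> S"
  using mem_is_interval_1_I[OF S(1) S(2)] by blast

lemma
  assumes "0 < x" "x < u" "u \<in> S"
  shows a_deriv_at: "(a has_real_derivative - (a x * (compl_E (a x) + a x * compl_K (a x) * cos (b x)))) (at x)"
    and b_deriv_at: "(b has_real_derivative a x * sin (b x) * compl_Q (a x)) (at x)"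
proof -
  have *: "{0<..<u} \<subseteq> S" using between[OF assms(3)] by auto
  have x: "x \<in> S" "x \<in> {0<..<u}" using assms * by auto
  have eq: "at x within {0<..<u} = at x"
    using x(2) by (intro at_within_open) auto
  show "(a has_real_derivative - (a x * (compl_E (a x) + a x * compl_K (a x) * cos (b x)))) (at x)"
    using DERIV_subset[OF a_deriv[OF x(1)] *] by (simp add: eq)
  show "(b has_real_derivative a x * sin (b x) * compl_Q (a x)) (at x)"
    using DERIV_subset[OF b_deriv[OF x(1)] *] by (simp add: eq)
qed

lemma a_cont: "continuous_on S a" and b_cont: "continuous_on S b"
  by (rule DERIV_continuous_on, erule a_deriv b_deriv)+

lemma a_less_1: "u \<in> S \<Longrightarrow> 0 < u \<Longrightarrow> a u < 1"
  using a_rng a_eq_1 by (metis less_le)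

text \<open>\<open>b' > 0\<close> holds only after the flat torus: at \<open>u = 0\<close> the
  factor \<open>compl_Q 1\<close> is 0. Hence the criterion with positivity on the open
  interval.\<close>

lemma b_strict_mono:
  assumes "u \<in> S" "v \<in> S" "u < v"
  shows "b u < b v"
proof (rule DERIV_pos_imp_increasing_open[OF assms(3)])
  fix x assume x: "u < x" "x < v"
  then have x0: "0 < x" using S_nonneg[OF assms(1)] by simp
  then have xS: "x \<in> S" using between[OF assms(2)] x by simp
  have "0 < a x * sin (b x) * compl_Q (a x)"
    using a_rng[OF xS] b_rng[OF xS] compl_Q_pos[of "a x"] a_less_1[OF xS x0] sin_gt_zero[of "b x"] by simp
  with b_deriv_at[OF x0 x(2) assms(2)] show "\<exists>y. (b has_real_derivative y) (at x) \<and> 0 < y" by blast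
next
  show "continuous_on {u..v} b"
    using between[OF assms(2)] S_nonneg[OF assms(1)]
    by (intro continuous_on_subset[OF b_cont]) auto
qed

section \<open>The first integral\<close>

text \<open>The substitution \<open>x = b u * v\<close> makes the limits of integration constant.\<close>

definition period :: "real \<Rightarrow> real" where
  "period u = integral (cbox 0 1) (\<lambda>v. b u * period_den (a u) (b u * v))"

lemma bv_rng:
  assumes "u \<in> S" "v \<in> cbox 0 1"
  shows "0 \<le> b u * v \<and> b u * v < pi"
proof -
  have "b u * v \<le> b u * 1" using assms b_rng[of u] by (intro mult_left_mono) auto
  moreover have "0 \<le> b u * v" using assms b_rng[of u] by simp
  ultimately show ?thesis using b_rng[OF assms(1)] by linarith
qed

lemma period_continuous: "continuous_on S period"
  unfolding period_def[abs_def]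
proof (rule integral_continuous_on_param)
  have c: "continuous_on (S \<times> cbox 0 1) (\<lambda>x. a (fst x))" "continuous_on (S \<times> cbox 0 1) (\<lambda>x. b (fst x))"
    by (auto intro!: continuous_on_compose2[OF a_cont] continuous_on_compose2[OF b_cont] continuous_intros)
  then show "continuous_on (S \<times> cbox 0 1) (\<lambda>(u, v). b u * period_den (a u) (b u * v))"
    unfolding split_beta
    by (intro continuous_intros continuous_on_period_den c) (use a_rng bv_rng in auto)
qed

text \<open>The time derivative of the integrand is itself a derivative in \<open>v\<close>, so only
  boundary terms remain, and these cancel by the flow equations. For \<open>x > 0\<close> one has
  \<open>a x < 1\<close>, so the partial derivatives of \<open>period_den\<close> apply.\<close>

lemma period_deriv:
  assumes x: "0 < x" "x < u" and u: "u \<in> S"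
  shows "(period has_real_derivative 0) (at x)"
proof -
  let ?U = "{0<..<u}"
  define a' b' where "a' x = - (a x * (compl_E (a x) + a x * compl_K (a x) * cos (b x)))"
    and "b' x = a x * sin (b x) * compl_Q (a x)" for x
  \<comment> \<open>The derivative in \<open>x\<close> of
    \<open>b x * period_den (a x) (b x * v)\<close>, by the product and chain rules.\<close>
  define G where "G x v = b' x * period_den (a x) (b x * v)
      + (a' x * period_den_a (a x) (b x * v) + b' x * v * period_den_b (a x) (b x * v)) * b x" for x v
  have US: "?U \<subseteq> S" using between[OF u] by auto
  have rng: "0 < a y \<and> a y < 1" if "y \<in> ?U" for y
    using that US a_rng a_less_1 by auto
  have eq: "at y within ?U = at y" if "y \<in> ?U" for y
    using that by (intro at_within_open) auto
  have da: "(a has_real_derivative a' y) (at y)" and db: "(b has_real_derivative b' y) (at y)"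
    if "y \<in> ?U" for y
    using that a_deriv_at[of y u] b_deriv_at[of y u] u by (auto simp: a'_def b'_def)
  have dP: "((\<lambda>y. period_den (a y) (b y * v)) has_real_derivative
       a' y * period_den_a (a y) (b y * v) + b' y * v * period_den_b (a y) (b y * v)) (at y)"
    if "y \<in> ?U" "v \<in> cbox 0 1" for y v
    using that bv_rng[of y v] rng US
    by (intro period_den_has_derivative da DERIV_cmult_right db) auto
  have ca: "continuous_on ?U a" and cb: "continuous_on ?U b"
    using US a_cont b_cont continuous_on_subset by blast+
  have c: "continuous_on (?U \<times> cbox 0 1) (\<lambda>x. a (fst x))" "continuous_on (?U \<times> cbox 0 1) (\<lambda>x. b (fst x))"
    by (auto intro!: continuous_on_compose2[OF ca] continuous_on_compose2[OF cb] continuous_intros)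
  have rng2: "0 < a (fst z) \<and> a (fst z) < 1 \<and> a (fst z) \<le> 1
      \<and> 0 \<le> b (fst z) * snd z \<and> b (fst z) * snd z < pi" if "z \<in> ?U \<times> cbox (0::real) 1" for z
    using that rng[of "fst z"] bv_rng[of "fst z" "snd z"] US by auto
  have lim: "((\<lambda>x. integral (cbox 0 1) (\<lambda>v. b x * period_den (a x) (b x * v))) has_real_derivative
      integral (cbox 0 1) (G x)) (at x within ?U)"
  proof (rule leibniz_rule_field_derivative)
    fix y v :: real assume y: "y \<in> ?U" and v: "v \<in> cbox 0 1"
    show "((\<lambda>x. b x * period_den (a x) (b x * v)) has_real_derivative G y v) (at y within ?U)"
      unfolding eq[OF y]
      by (rule DERIV_cong[OF DERIV_mult[OF db dP]]) (use y v in \<open>auto simp: G_def\<close>)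
  next
    fix y assume y: "y \<in> ?U"
    show "(\<lambda>v. b y * period_den (a y) (b y * v)) integrable_on cbox 0 1"
      by (intro integrable_continuous continuous_intros continuous_on_period_den)
         (use y rng[of y] bv_rng[of y] US in auto)
  next
    show "continuous_on (?U \<times> cbox 0 1) (\<lambda>(x, v). G x v)"
      unfolding split_beta G_def a'_def b'_def
      by (intro continuous_intros c continuous_on_period_den continuous_on_period_den_ab)
         (use rng2 in blast)+
  qed (use x in auto)
  \<comment> \<open>A primitive of \<open>G x\<close> in \<open>v\<close>: \<open>v * b'\<close>
    times the density collects the terms in \<open>b'\<close>, and
    \<open>period_den_primitive\<close> integrates those in \<open>a'\<close>.\<close>
  have "(G x has_integral
       ((1 * b' x * period_den (a x) (b x * 1) + a' x * (compl_Q (a x) * sin (b x * 1) / sqrt (chord_sq (a x) (b x * 1))))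
      - (0 * b' x * period_den (a x) (b x * 0) + a' x * (compl_Q (a x) * sin (b x * 0) / sqrt (chord_sq (a x) (b x * 0))))))
      {0..1}"
  proof (rule fundamental_theorem_of_calculus)
    fix v :: real assume v: "v \<in> {0..1}"
    have xU: "x \<in> ?U" using x by simp
    have br: "0 \<le> b x * v" "b x * v < pi" using bv_rng[of x v] v xU US by auto
    have dv: "((\<lambda>v. b x * v) has_real_derivative b x) (at v)" by (auto intro!: derivative_eq_intros)
    have 1: "((\<lambda>v. period_den (a x) (b x * v)) has_real_derivative b x * period_den_b (a x) (b x * v)) (at v)"
      using period_den_has_derivative[OF DERIV_const dv, of "a x"] rng[OF xU] br by simp
    have 2: "((\<lambda>v. compl_Q (a x) * sin (b x * v) / sqrt (chord_sq (a x) (b x * v))) has_real_derivative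
        period_den_a (a x) (b x * v) * b x) (at v)"
      using DERIV_chain2[OF period_den_primitive dv] rng[OF xU] br by simp
    have "((\<lambda>v. v * b' x * period_den (a x) (b x * v)
        + a' x * (compl_Q (a x) * sin (b x * v) / sqrt (chord_sq (a x) (b x * v)))) has_real_derivative G x v) (at v)"
      by (rule DERIV_cong[OF DERIV_add[OF DERIV_mult[OF DERIV_cmult_right[OF DERIV_ident] 1] DERIV_cmult[OF 2]]])
         (simp add: G_def algebra_simps)
    then show "((\<lambda>v. v * b' x * period_den (a x) (b x * v)
        + a' x * (compl_Q (a x) * sin (b x * v) / sqrt (chord_sq (a x) (b x * v)))) has_vector_derivative G x v) (at v within {0..1})"
      by (simp add: has_real_derivative_iff_has_vector_derivative [symmetric] has_field_derivative_at_within)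
  qed simp
  from integral_unique[OF this]
  have "integral {0..1} (G x) = b' x * period_den (a x) (b x) + a' x * (compl_Q (a x) * sin (b x) / sqrt (chord_sq (a x) (b x)))"
    by (simp only: mult_1_left mult_1_right mult_zero_left mult_zero_right sin_zero div_0 add_0_right diff_0_right)
  \<comment> \<open>With the flow inserted, both terms are \<open>a * compl_Q a * sin b\<close>
    times the density, with opposite signs.\<close>
  also have "\<dots> = 0"
    by (simp add: period_den_def a'_def b'_def)
  finally have "integral {0..1} (G x) = 0" .
  with lim have "((\<lambda>x. integral (cbox 0 1) (\<lambda>v. b x * period_den (a x) (b x * v))) has_real_derivative 0) (at x within ?U)"
    by (simp only: cbox_interval)
  moreover have "x \<in> ?U" using x by simp
  ultimately show ?thesis
    by (simp only: eq period_def[abs_def] cbox_interval)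
qed

text \<open>Continuity carries the constant to the flat torus \<open>u = 0\<close>, which
  \<open>period_deriv\<close> does not reach.\<close>

lemma period_const: "u \<in> S \<Longrightarrow> period u = period 0"
proof (cases "u = 0")
  case False
  assume u: "u \<in> S"
  with False have "0 < u" using S_nonneg[of u] by simp
  then show ?thesis
  proof (rule DERIV_isconst_end)
    show "continuous_on {0..u} period"
      using between[OF u] by (intro continuous_on_subset[OF period_continuous]) auto
  qed (use period_deriv u in auto)
qed simp

text \<open>At \<open>a = 1\<close> both complete integrals are \<open>pi / 2\<close> and the
  modulus is \<open>2 * cos (x / 2)\<close>, so the density reduces to
  \<open>pi / 2 * cos (x / 2)\<close>.\<close>

lemma period_0: "period 0 = pi * sin (b 0 / 2)"
proof -
  have a0: "a 0 = 1" using a_eq_1[OF S(2)] by simp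
  have "((\<lambda>v. b 0 * (pi / 2 * cos (b 0 * v / 2))) has_integral
      (pi * sin (b 0 * 1 / 2) - pi * sin (b 0 * 0 / 2))) {0..1}"
    by (rule fundamental_theorem_of_calculus)
       (auto intro!: derivative_eq_intros simp: has_real_derivative_iff_has_vector_derivative [symmetric])
  then have *: "((\<lambda>v. b 0 * (pi / 2 * cos (b 0 * v / 2))) has_integral pi * sin (b 0 / 2)) {0..1}"
    by simp
  have "((\<lambda>v. b 0 * period_den (a 0) (b 0 * v)) has_integral pi * sin (b 0 / 2)) {0..1}"
  proof (rule has_integral_eq[OF _ *])
    fix v :: real assume "v \<in> {0..1}"
    then have br: "0 \<le> b 0 * v" "b 0 * v < pi" using bv_rng[OF S(2), of v] by auto
    define x where "x = b 0 * v"
    define c where "c = cos (x / 2)"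
    have c: "c > 0" unfolding c_def x_def using br by (intro cos_gt_zero_pi) auto
    have cc: "cos x = 2 * c\<^sup>2 - 1"
      using cos_double_cos[of "x / 2"] by (simp add: c_def)
    have "chord_sq 1 x = (2 * c)\<^sup>2" by (simp add: chord_sq_def cc power2_eq_square)
    then have "period_den 1 x = pi / 2 * (1 + cos x) / (2 * c)"
      using c real_sqrt_abs[of "2 * c"] by (simp add: period_den_def compl_E_1 compl_K_1 field_simps del: power_mult_distrib real_sqrt_abs)
    also have "\<dots> = pi / 2 * c" using c by (simp add: cc power2_eq_square)
    finally show "b 0 * (pi / 2 * cos (b 0 * v / 2)) = b 0 * period_den (a 0) (b 0 * v)"
      by (simp add: a0 c_def x_def)
  qed
  from integral_unique[OF this] show ?thesis by (simp only: period_def cbox_interval)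
qed

section \<open>The limit of the angle at the bouquet\<close>

text \<open>The root of \<open>chord_sq\<close> lies between \<open>1 - a\<close> and
  \<open>1 + a\<close>, so the density lies between \<open>(E' - a K') / (1 + a)\<close> and
  \<open>(E' + a K') / (1 - a)\<close>. Integration confines \<open>b u\<close> in terms of the
  conserved value \<open>period 0\<close>. The assumption \<open>EK\<close> makes the lower bound of
  the density positive.\<close>

lemma b_bounds:
  assumes u: "u \<in> S" "0 < u" and EK: "a u * compl_K (a u) < compl_E (a u)"
  shows "(1 - a u) * period 0 / (compl_E (a u) + a u * compl_K (a u)) \<le> b u"
    and "b u \<le> (1 + a u) * period 0 / (compl_E (a u) - a u * compl_K (a u))"
proof -
  define A E c where "A = a u" and "E = compl_E (a u)" and "c = a u * compl_K (a u)"
  have A: "0 < A" "A < 1" using a_rng[OF u(1)] a_less_1[OF u] by (auto simp: A_def)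
  have b: "b u > 0" using b_rng[OF u(1)] by simp
  have compl_K: "compl_K A \<ge> 0" unfolding compl_K_def by (intro integral_nonneg integrable_continuous_interval continuous_intros)
      (use A in auto)
  then have c: "0 \<le> c" "c < E" using A EK by (auto simp: c_def E_def A_def)
  have bds: "(E - c) / (1 + A) \<le> period_den A x \<and> period_den A x \<le> (E + c) / (1 - A)"
    if "0 \<le> x" "x < pi" for x
  proof -
    have w: "chord_sq A x > 0" using A that by (intro chord_sq_pos) auto
    have "sqrt (chord_sq A x) \<le> 1 + A"
    proof (rule real_le_lsqrt)
      have "2 * A * cos x \<le> 2 * A * 1" using A by (intro mult_left_mono) auto
      then show "chord_sq A x \<le> (1 + A)\<^sup>2" by (simp add: chord_sq_def power2_eq_square algebra_simps)
    qed (use A in auto)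
    moreover have "1 - A \<le> sqrt (chord_sq A x)"
    proof (rule real_le_rsqrt)
      have "2 * A * (-1) \<le> 2 * A * cos x" using A by (intro mult_left_mono) auto
      then show "(1 - A)\<^sup>2 \<le> chord_sq A x" by (simp add: chord_sq_def power2_eq_square algebra_simps)
    qed
    moreover have "c * (-1) \<le> c * cos x" "c * cos x \<le> c * 1"
      using c by (intro mult_left_mono; simp)+
    ultimately have "(E - c) / (1 + A) \<le> (E + c * cos x) / sqrt (chord_sq A x)"
      "(E + c * cos x) / sqrt (chord_sq A x) \<le> (E + c) / (1 - A)"
      using c A w by (intro frac_le; simp)+
    then show ?thesis by (simp add: period_den_def E_def c_def A_def)
  qed
  have cont: "continuous_on {0..1} (\<lambda>v. b u * period_den A (b u * v))"
    by (intro continuous_intros continuous_on_period_den) (use A bv_rng[OF u(1)] in auto)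
  have p: "period 0 = integral {0..1} (\<lambda>v. b u * period_den A (b u * v))"
    using period_const[OF u(1)] by (simp add: period_def A_def)
  have "integral {0..1} (\<lambda>v::real. b u * ((E - c) / (1 + A))) \<le> period 0"
    unfolding p using bv_rng[OF u(1)] b
    by (intro integral_le integrable_continuous_interval cont continuous_intros mult_left_mono bds[THEN conjunct1]) auto
  then have 1: "b u * ((E - c) / (1 + A)) \<le> period 0" by simp
  have "period 0 \<le> integral {0..1} (\<lambda>v::real. b u * ((E + c) / (1 - A)))"
    unfolding p using bv_rng[OF u(1)] b
    by (intro integral_le integrable_continuous_interval cont continuous_intros mult_left_mono bds[THEN conjunct2]) auto
  then have 2: "period 0 \<le> b u * ((E + c) / (1 - A))" by simp
  have "0 < E + c" "0 < E - c" "0 < 1 - A" "0 < 1 + A" using A c by auto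
  then have "(1 - A) * period 0 / (E + c) \<le> b u" "b u \<le> (1 + A) * period 0 / (E - c)"
    using 1 2 by (simp_all add: divide_le_eq le_divide_eq mult.commute)
  then show "(1 - a u) * period 0 / (compl_E (a u) + a u * compl_K (a u)) \<le> b u"
    and "b u \<le> (1 + a u) * period 0 / (compl_E (a u) - a u * compl_K (a u))"
    by (simp_all add: A_def E_def c_def)
qed

text \<open>Both bounds of \<open>b_bounds\<close> tend to \<open>period 0\<close>. The filter is
  arbitrary because the limit is taken twice: along a section of \<open>a\<close>, and along times
  of the family at which \<open>q\<close> tends to 0.\<close>

lemma b_tendsto:
  assumes F: "filterlim f (principal S) F" and af: "((\<lambda>x. a (f x)) \<longlongrightarrow> 0) F"
  shows "((\<lambda>x. b (f x)) \<longlongrightarrow> pi * sin (b 0 / 2)) F"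
proof -
  have evS: "eventually (\<lambda>x. f x \<in> S) F"
    using F by (simp add: filterlim_principal)
  then have "filterlim (\<lambda>x. a (f x)) (at_right 0) F"
    by (auto intro!: tendsto_imp_filterlim_at_right[OF af] elim!: eventually_mono simp: a_rng)
  then have E: "((\<lambda>x. compl_E (a (f x))) \<longlongrightarrow> 1) F" and c: "((\<lambda>x. a (f x) * compl_K (a (f x))) \<longlongrightarrow> 0) F"
    by (rule filterlim_compose[OF compl_E_tendsto_1] filterlim_compose[OF mult_compl_K_tendsto_0])+
  have "eventually (\<lambda>x. a (f x) * compl_K (a (f x)) < 1/2) F" "eventually (\<lambda>x. 1/2 < compl_E (a (f x))) F"
    "eventually (\<lambda>x. a (f x) < 1) F"
    using order_tendstoD(2)[OF c, of "1/2"] order_tendstoD(1)[OF E, of "1/2"] order_tendstoD(2)[OF af, of 1] by auto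
  \<comment> \<open>\<open>b_bounds\<close> needs \<open>0 < f x\<close>; the flat torus is excluded
    once \<open>a < 1\<close>.\<close>
  with evS have ev: "eventually (\<lambda>x. f x \<in> S \<and> 0 < f x \<and> a (f x) * compl_K (a (f x)) < compl_E (a (f x))) F"
  proof eventually_elim
    case (elim x)
    then have "f x \<noteq> 0" using a_eq_1[of "f x"] by auto
    with elim S_nonneg[of "f x"] show ?case by auto
  qed
  have "((\<lambda>x. (1 - a (f x)) * period 0 / (compl_E (a (f x)) + a (f x) * compl_K (a (f x)))) \<longlongrightarrow> (1 - 0) * period 0 / (1 + 0)) F"
    "((\<lambda>x. (1 + a (f x)) * period 0 / (compl_E (a (f x)) - a (f x) * compl_K (a (f x)))) \<longlongrightarrow> (1 + 0) * period 0 / (1 - 0)) F"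
    by (intro tendsto_intros E c af; simp)+
  then have "((\<lambda>x. b (f x)) \<longlongrightarrow> period 0) F"
    unfolding diff_0_right add_0_right mult_1_left div_by_1
  proof (rule tendsto_sandwich[rotated 2])
    show "eventually (\<lambda>x. (1 - a (f x)) * period 0 / (compl_E (a (f x)) + a (f x) * compl_K (a (f x))) \<le> b (f x)) F"
      using ev by eventually_elim (rule b_bounds; blast)
    show "eventually (\<lambda>x. b (f x) \<le> (1 + a (f x)) * period 0 / (compl_E (a (f x)) - a (f x) * compl_K (a (f x)))) F"
      using ev by eventually_elim (rule b_bounds; blast)
  qed
  then show ?thesis by (simp add: period_0)
qed

text \<open>Monotonicity of \<open>a\<close> has not been established, so the approach to the
  bouquet is described by a section \<open>g\<close> of \<open>a\<close>, evaluated at values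
  tending to 0.\<close>

lemma
  shows b_less: "u \<in> S \<Longrightarrow> b u < pi * sin (b 0 / 2)"
    and b_approx: "y < pi * sin (b 0 / 2) \<Longrightarrow> \<exists>u\<in>S. y < b u"
proof -
  have "\<exists>u\<in>S. a u = x" if "x \<in> {0<..1}" for x
    using that unfolding a_image [symmetric] by blast
  then obtain g where g: "\<And>x. x \<in> {0<..1} \<Longrightarrow> g x \<in> S \<and> a (g x) = x" by metis
  have near: "eventually (\<lambda>x::real. 0 < x \<and> x < m) (at_right 0)" if "m > 0" for m
    using that by (auto simp: eventually_at_right_field)
  have "eventually (\<lambda>x. g x \<in> S \<and> a (g x) = x) (at_right 0)"
    using near[OF zero_less_one] by eventually_elim (use g in auto)
  then have "filterlim g (principal S) (at_right 0)" "eventually (\<lambda>x. x = a (g x)) (at_right 0)"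
    by (auto simp: filterlim_principal elim: eventually_mono)
  then have lim: "((\<lambda>x. b (g x)) \<longlongrightarrow> pi * sin (b 0 / 2)) (at_right 0)"
    by (intro b_tendsto) (auto intro: Lim_transform_eventually)
  show "\<exists>u\<in>S. y < b u" if "y < pi * sin (b 0 / 2)"
  proof -
    have "eventually (\<lambda>x. 0 < x \<and> x < 1 \<and> y < b (g x)) (at_right 0)"
      using order_tendstoD(1)[OF lim that] near[OF zero_less_one] by eventually_elim auto
    then obtain x where "0 < x" "x < 1" "y < b (g x)"
      using eventually_happens trivial_limit_at_right_real by blast
    with g[of x] show ?thesis by auto
  qed
  \<comment> \<open>\<open>a\<close> has a positive minimum on the compact interval from 0 to
    \<open>u\<close>, so smaller values are attained only after \<open>u\<close>.\<close>
  have later: "\<exists>m>0. \<forall>x. 0 < x \<and> x < m \<longrightarrow> g x \<in> S \<and> u < g x" if u: "u \<in> S" for u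
  proof -
    have sub: "{0..u} \<subseteq> S" using between[OF u] by auto
    have "{0..u} \<noteq> {}" using S_nonneg[OF u] by auto
    then obtain x0 where x0: "x0 \<in> {0..u}" "\<forall>x\<in>{0..u}. a x0 \<le> a x"
      using continuous_attains_inf[OF compact_Icc _ continuous_on_subset[OF a_cont sub]] by blast
    have "0 < a x0" "a x0 \<le> 1" using a_rng sub x0(1) by auto
    moreover have "g x \<in> S \<and> u < g x" if "0 < x" "x < a x0" for x
    proof -
      have "g x \<in> S" "a (g x) = x" using g[of x] that \<open>a x0 \<le> 1\<close> by auto
      moreover from this have "\<not> g x \<le> u" using x0(2) S_nonneg[of "g x"] that by force
      ultimately show ?thesis by simp
    qed
    ultimately show ?thesis by blast
  qed
  show "b u < pi * sin (b 0 / 2)" if u: "u \<in> S"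
  proof -
    obtain m where m: "m > 0" "\<And>x. 0 < x \<Longrightarrow> x < m \<Longrightarrow> g x \<in> S \<and> u < g x"
      using later[OF u] by blast
    \<comment> \<open>The limit yields only \<open>\<le>\<close>; an intermediate time
      \<open>u1\<close> after \<open>u\<close> makes the inequality strict.\<close>
    define u1 where "u1 = g (m / 2)"
    have u1: "u1 \<in> S" "u < u1" using m(2)[of "m / 2"] m(1) by (auto simp: u1_def)
    obtain m1 where m1: "m1 > 0" "\<And>x. 0 < x \<Longrightarrow> x < m1 \<Longrightarrow> g x \<in> S \<and> u1 < g x"
      using later[OF u1(1)] by blast
    have "eventually (\<lambda>x. b u1 \<le> b (g x)) (at_right 0)"
      using near[OF m1(1)] by eventually_elim (use m1(2) b_strict_mono[OF u1(1)] less_imp_le in blast)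
    then have "b u1 \<le> pi * sin (b 0 / 2)"
      by (intro tendsto_lowerbound[OF lim]) auto
    with b_strict_mono[OF u u1] show ?thesis by simp
  qed
qed

end

section \<open>Mean curvature and flat tori\<close>

lemma sym_point_neq_imp_sin:
  assumes "sym_point x \<noteq> sym_point y"
  shows "sin (x - y) \<noteq> 0"
proof
  assume "sin (x - y) = 0"
  then have "cis (2 * (x - y)) = 1"
    using cos_double_sin[of "x - y"] sin_double[of "x - y"] by (simp add: complex_eq_iff)
  then have "cis (2 * y) * cis (2 * (x - y)) = cis (2 * y)" by simp
  then show False using assms by (simp add: sym_point_def cis_mult algebra_simps)
qed

text \<open>The Hopf term is trace-free: its contributions \<open>r\<close> and \<open>- r\<close>
  cancel. That the conformal factor \<open>G\<close> is nonzero follows from injectivity of the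
  differential.\<close>

lemma mean_curvature_equivariant_cmc:
  assumes eq: "equivariant_cmc q x y f (\<lambda>p. \<sigma> *\<^sub>R N p)" and \<sigma>: "\<sigma> \<in> {1, -1}"
  shows "mean_curvature f N p = \<sigma> * cot (x - y)"
proof -
  obtain p1 p2 where p: "p = (p1, p2)" by (cases p)
  define G where "G = (sin (x - y))\<^sup>2 * (jacobi_dn p2 (1 - q\<^sup>2))\<^sup>2"
  define r where "r = Re (hopf q x y)"
  from eq have I: "first_ff f p u w = G * (u \<bullet> w)"
    and II: "second_ff f (\<lambda>p. \<sigma> *\<^sub>R N p) p u w = cot (x - y) * (G * (u \<bullet> w))
        + Re (hopf q x y * Complex (fst u) (snd u) * Complex (fst w) (snd w))" for u w
    unfolding equivariant_cmc_def p G_def Let_def by blast+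
  have \<sigma>2: "\<sigma> * \<sigma> = 1" using \<sigma> by auto
  have II': "second_ff f N p u w = \<sigma> * second_ff f (\<lambda>p. \<sigma> *\<^sub>R N p) p u w" for u w
    by (simp add: second_ff_def mult.assoc [symmetric] \<sigma>2)
  have "immersion_S3 f" using eq by (simp add: equivariant_cmc_def)
  then have d: "f differentiable (at p)" "inj (frechet_derivative f (at p))"
    unfolding immersion_S3_def C2_map_def by blast+
  have "frechet_derivative f (at p) 0 = 0"
    by (rule linear_0[OF linear_frechet_derivative[OF d(1)]])
  moreover have "(1::real, 0::real) \<noteq> 0" by (simp add: zero_prod_def)
  ultimately have "dird (1, 0) f p \<noteq> 0"
    unfolding dird_def using injD[OF d(2), of "(1, 0)" 0] by metis
  then have "first_ff f p (1, 0) (1, 0) \<noteq> 0" by (simp add: first_ff_def)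
  then have G: "G \<noteq> 0" by (simp add: I)
  have "second_ff f N p (1, 0) (1, 0) = \<sigma> * (cot (x - y) * G + r)"
    "second_ff f N p (0, 1) (0, 1) = \<sigma> * (cot (x - y) * G - r)"
    by (simp_all add: II' II r_def)
  then have "mean_curvature f N p
      = (\<sigma> * (cot (x - y) * G + r) * G + \<sigma> * (cot (x - y) * G - r) * G) / (2 * G\<^sup>2)"
    by (simp add: mean_curvature_def Let_def I power2_eq_square)
  also have "\<dots> = (\<sigma> * cot (x - y)) * (2 * G\<^sup>2) / (2 * G\<^sup>2)"
    by (rule arg_cong[where f = "\<lambda>z. z / _"]) (simp add: power2_eq_square algebra_simps)
  also have "\<dots> = \<sigma> * cot (x - y)" using G by simp
  finally show ?thesis .
qed

text \<open>The vanishing middle entry forces \<open>s1 = s2\<close> or \<open>s1 = - s2\<close>, so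
  \<open>l2 = \<bar>s1\<bar>\<close>, while \<open>2 * l0 = \<bar>s0\<bar>\<close>. Squaring removes
  the signs and gives \<open>4 * \<rho>\<^sup>2 * W y = (sin (x - y))\<^sup>2\<close>; for a surface
  of revolution the right side is \<open>4 * W y * (1 - W y)\<close>.\<close>

lemma flat_triple_angle:
  assumes ft: "flat_triple q x y (l0, 0, l2)" and k: "(cos (x + y))\<^sup>2 = 1"
    and l: "0 < l0" "0 < l2" and \<rho>: "\<rho> = real_of_int l0 / real_of_int l2"
  shows "q * cos (x + y) * cos (x - y) = 2 * \<rho>\<^sup>2 - 1"
proof -
  have q: "q = 1 \<or> q = -1" using ft by (auto simp: flat_triple_def)
  define m0 where "m0 = csqrt (of_real (sgn q))"
  from ft obtain s0 s1 s2 :: int and r :: real where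
    s0: "of_int s0 = of_real r * (\<i> * (cis x * cnj (cis y) - cis y * cnj (cis x)))" and
    s1: "of_int s1 = of_real r * (\<i> * (cis y * cnj m0 - m0 * cnj (cis y)))" and
    s2: "of_int s2 = of_real r * (\<i> * (m0 * cnj (cis x) - cis x * cnj m0))" and
    l0: "2 * l0 = \<bar>s0\<bar>" and mn: "0 = min \<bar>s1 + s2\<bar> \<bar>s1 - s2\<bar>" and l2: "2 * l2 = max \<bar>s1 + s2\<bar> \<bar>s1 - s2\<bar>"
    by (auto simp: flat_triple_def m0_def Let_def)
  \<comment> \<open>\<open>m0\<close> is 1 for \<open>q = 1\<close> and \<open>\<i>\<close> for
    \<open>q = -1\<close>, so the last two components of the cross product reduce to sines or
    cosines; \<open>W\<close> is their square up to the factor \<open>4 * r\<^sup>2\<close>.\<close>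
  define W where "W z = (if q = 1 then (sin z)\<^sup>2 else (cos z)\<^sup>2)" for z :: real
  have 0: "(real_of_int s0)\<^sup>2 = 4 * r\<^sup>2 * (sin (x - y))\<^sup>2"
  proof -
    have "real_of_int s0 = - 2 * r * sin (x - y)"
      using arg_cong[OF s0, of Re] by (simp add: sin_diff algebra_simps)
    then show ?thesis by (simp add: power_mult_distrib)
  qed
  have 12: "(real_of_int s1)\<^sup>2 = 4 * r\<^sup>2 * W y" "(real_of_int s2)\<^sup>2 = 4 * r\<^sup>2 * W x"
  proof -
    have "real_of_int s1 = 2 * r * (if q = 1 then - sin y else cos y)"
      "real_of_int s2 = 2 * r * (if q = 1 then sin x else - cos x)"
      using q arg_cong[OF s1, of Re] arg_cong[OF s2, of Re] by (auto simp: m0_def algebra_simps)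
    then show "(real_of_int s1)\<^sup>2 = 4 * r\<^sup>2 * W y" "(real_of_int s2)\<^sup>2 = 4 * r\<^sup>2 * W x"
      by (simp_all add: W_def power_mult_distrib)
  qed
  have s12: "s1 = s2 \<or> s1 = - s2" using mn by (auto simp: min_def split: if_splits)
  have "s1\<^sup>2 = s2\<^sup>2" "l2\<^sup>2 = s1\<^sup>2" "4 * l0\<^sup>2 = s0\<^sup>2"
  proof -
    show "s1\<^sup>2 = s2\<^sup>2" using s12 by auto
    from s12 l2 have "l2 = \<bar>s1\<bar>" by (auto simp: max_def split: if_splits)
    then show "l2\<^sup>2 = s1\<^sup>2" by simp
    have "s0\<^sup>2 = (2 * l0)\<^sup>2" unfolding l0 by simp
    then show "4 * l0\<^sup>2 = s0\<^sup>2" by (simp add: power_mult_distrib)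
  qed
  then have "real_of_int (s1\<^sup>2) = real_of_int (s2\<^sup>2)" "real_of_int (l2\<^sup>2) = real_of_int (s1\<^sup>2)"
    "real_of_int (4 * l0\<^sup>2) = real_of_int (s0\<^sup>2)"
    by (simp_all only:)
  then have ss': "(real_of_int s1)\<^sup>2 = (real_of_int s2)\<^sup>2" "(real_of_int l2)\<^sup>2 = (real_of_int s1)\<^sup>2"
    and l0': "4 * (real_of_int l0)\<^sup>2 = (real_of_int s0)\<^sup>2"
    by simp_all
  have r: "r \<noteq> 0" using 0 l0' l by auto
  have WW: "W x = W y" using 12 ss' r by simp
  have "cos (x + y) * cos (x - y) = (cos x)\<^sup>2 - (sin y)\<^sup>2"
    unfolding cos_add cos_diff using sin_cos_squared_add[of x] sin_cos_squared_add[of y] by algebra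
  then have kh: "q * (cos (x + y) * cos (x - y)) = 1 - 2 * W y"
    using q WW by (auto simp: W_def cos_squared_eq)
  have "(cos (x - y))\<^sup>2 = (q * (cos (x + y) * cos (x - y)))\<^sup>2"
    using k q by (auto simp: power_mult_distrib)
  then have "(sin (x - y))\<^sup>2 = 4 * W y * (1 - W y)"
    unfolding kh by (simp add: sin_squared_eq) (simp add: power2_eq_square algebra_simps)
  then have "4 * (real_of_int l0)\<^sup>2 = 4 * (4 * r\<^sup>2 * W y) * (1 - W y)"
    unfolding l0' 0 by (simp add: mult_ac)
  also have "4 * r\<^sup>2 * W y = (real_of_int l2)\<^sup>2" using 12(1) ss'(2) by simp
  finally have "\<rho>\<^sup>2 = 1 - W y"
    using l by (simp add: \<rho> power_divide field_simps)
  with kh show ?thesis by simp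
qed

lemma cot_less:
  assumes "0 < x" "x < y" "y < pi"
  shows "cot y < cot (x::real)"
proof -
  have s: "sin x > 0" "sin y > 0" "sin (y - x) > 0" using assms by (auto intro!: sin_gt_zero)
  have "cot x - cot y = sin (y - x) / (sin x * sin y)"
    using s by (simp add: cot_def sin_diff field_simps)
  with s show ?thesis by (metis divide_pos_pos mult_pos_pos diff_gt_0_iff_gt)
qed

lemma two_square_ne_square:
  fixes l0 l2 :: int
  assumes "coprime l0 l2"
  shows "2 * l0\<^sup>2 \<noteq> l2\<^sup>2"
proof
  assume eq: "2 * l0\<^sup>2 = l2\<^sup>2"
  then have "even (l2\<^sup>2)" by (metis dvd_triv_left)
  then have e2: "even l2" by simp
  then obtain c where "l2 = 2 * c" by blast
  with eq have "l0\<^sup>2 = 2 * c\<^sup>2" by (simp add: power2_eq_square)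
  then have "even (l0\<^sup>2)" by simp
  then have "even l0" by simp
  with e2 show False using coprime_common_divisor[OF assms, of 2] by simp 
qed

section \<open>The families of tori of revolution\<close>

text \<open>Continuous functions with values in \<open>{1, -1}\<close> are constant on
  \<open>T\<close>. This fixes \<open>k\<close>, the sign of \<open>q\<close> and that of
  \<open>sin (\<theta>1 - \<theta>2)\<close>, so one sign \<open>c\<close> relates the mean
  curvature to \<open>cot b\<close> along the whole family.\<close>

lemma revolution_family_reduced_flow:
  assumes fam: "revolution_family l0 l2 T t0 q \<theta>1 \<theta>2 f N"
    and l: "0 < l0" "l0 < l2" and \<rho>: "\<rho> = real_of_int l0 / real_of_int l2"
  obtains S a b k c where "revolution_flow S a b" and "k \<in> {1, -1::real}"
    and "\<And>u. u \<in> S \<longleftrightarrow> t0 - k * u \<in> T"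
    and "\<And>t. t \<in> T \<Longrightarrow> \<bar>t - t0\<bar> = k * (t0 - t)"
    and "\<And>t. t \<in> T \<Longrightarrow> a \<bar>t - t0\<bar> = \<bar>q t\<bar>"
    and "cos (b 0) = 1 - 2 * \<rho>\<^sup>2"
    and "c \<in> {1, -1}"
    and "\<And>t p. t \<in> T \<Longrightarrow> mean_curvature (f t) (N t) p = c * cot (b \<bar>t - t0\<bar>)"
proof -
  define h where "h t = cos (\<theta>1 t - \<theta>2 t)" for t
  from fam have T: "is_interval T" "t0 \<in> T" and cont\<theta>: "continuous_on T \<theta>1" "continuous_on T \<theta>2"
    and flow: "flow_curve T q (\<lambda>t. cos (\<theta>1 t + \<theta>2 t)) h"
    and k2: "\<And>t. t \<in> T \<Longrightarrow> (cos (\<theta>1 t + \<theta>2 t))\<^sup>2 = 1"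
    and ft: "flat_triple (q t0) (\<theta>1 t0) (\<theta>2 t0) (l0, 0, l2)"
    and q1: "\<And>t. t \<in> T - {t0} \<Longrightarrow> 0 < \<bar>q t\<bar> \<and> \<bar>q t\<bar> < 1"
    and q_image: "(\<lambda>t. \<bar>q t\<bar>) ` T = {0<..1}"
    unfolding revolution_family_def h_def by blast+
  from fam obtain \<sigma> where \<sigma>: "\<sigma> \<in> {1, -1}"
    and cmc: "\<And>t. t \<in> T \<Longrightarrow> equivariant_cmc (q t) (\<theta>1 t) (\<theta>2 t) (f t) (\<lambda>p. \<sigma> *\<^sub>R N t p)"
    unfolding revolution_family_def by blast
  have connT: "connected T" using T(1) is_interval_connected_1 by blast
  have const: "g t = g t0" if "continuous_on T g" "g ` T \<subseteq> {1, -1}" "t \<in> T" for g :: "real \<Rightarrow> real" and t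
  proof -
    have "g constant_on T"
      using continuous_finite_range_constant[OF connT that(1)] finite_subset[OF that(2)] by simp
    then show ?thesis using that(3) T(2) by (auto simp: constant_on_def)
  qed
  have q_rng: "0 < \<bar>q t\<bar> \<and> \<bar>q t\<bar> \<le> 1" if "t \<in> T" for t using q_image that by auto
  then have q_sq: "(q t)\<^sup>2 \<le> 1" if "t \<in> T" for t
    using that by (simp add: abs_square_le_1)
  have q_t0: "\<bar>q t0\<bar> = 1" using ft by (simp add: flat_triple_def)
  have sinn: "sin (\<theta>1 t - \<theta>2 t) \<noteq> 0" if "t \<in> T" for t
    using cmc[OF that] by (auto simp: equivariant_cmc_def intro!: sym_point_neq_imp_sin)

  \<comment> \<open>Signs that are constant along the family\<close>
  define k where "k = cos (\<theta>1 t0 + \<theta>2 t0)"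
  define e where "e = sgn (q t0)"
  define s where "s = sgn (sin (\<theta>1 t0 - \<theta>2 t0))"
  have k: "k \<in> {1, -1}" using k2[OF T(2)] by (auto simp: k_def power2_eq_1_iff)
  have k_const: "cos (\<theta>1 t + \<theta>2 t) = k" if "t \<in> T" for t
    unfolding k_def
    by (rule const[OF _ _ that])
       (use k2 in \<open>auto simp: power2_eq_1_iff intro!: continuous_intros cont\<theta>\<close>)
  have q_deriv: "(q has_real_derivative q t * (compl_E \<bar>q t\<bar> * k - q t * compl_K \<bar>q t\<bar> * h t)) (at t within T)"
    and h_deriv: "(h has_real_derivative q t * ((1 - (h t)\<^sup>2) / (1 - (q t)\<^sup>2)) *
           (2 * compl_E \<bar>q t\<bar> - (1 + (q t)\<^sup>2) * compl_K \<bar>q t\<bar>)) (at t within T)" if t: "t \<in> T" for t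
    using bspec[OF flow[unfolded flow_curve_def Let_def] t]
    unfolding k_const[OF t] ellE_eq_compl_E[OF q_sq[OF t]] ellK_eq_compl_K[OF q_sq[OF t]] by blast+
  have q_cont: "continuous_on T q" using q_deriv by (rule DERIV_continuous_on)
  have e_const: "sgn (q t) = e" if "t \<in> T" for t
    unfolding e_def
  proof (rule const[OF _ _ that])
    show "continuous_on T (\<lambda>t. sgn (q t))"
      by (intro continuous_on_sgn q_cont) (use q_rng in auto)
  qed (use q_rng in \<open>auto simp: sgn_if\<close>)
  have s_const: "sgn (sin (\<theta>1 t - \<theta>2 t)) = s" if "t \<in> T" for t
    unfolding s_def
  proof (rule const[OF _ _ that])
    show "continuous_on T (\<lambda>t. sgn (sin (\<theta>1 t - \<theta>2 t)))"
      by (intro continuous_on_sgn continuous_intros cont\<theta>) (use sinn in auto)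
  qed (use sinn in \<open>auto simp: sgn_if\<close>)
  have e: "e \<in> {1, -1}" using q_t0 by (auto simp: e_def sgn_if)
  have s: "s \<in> {1, -1}" using sinn[OF T(2)] by (auto simp: s_def sgn_if)
  have kk: "k * k = 1" "e * e = 1" "s * s = 1" using k e s by auto
  have qe: "q t = e * \<bar>q t\<bar>" "\<bar>q t\<bar> = e * q t" if "t \<in> T" for t
    using e_const[OF that] sgn_mult_abs[of "q t"] abs_sgn[of "q t"] by (simp_all only: mult.commute)
  \<comment> \<open>Distinct sym points keep \<open>h\<close> away from 1 and -1, where
    \<open>arccos\<close> is not differentiable.\<close>
  have h_lt: "\<bar>h t\<bar> < 1" if "t \<in> T" for t
  proof -
    have "(h t)\<^sup>2 < 1" using sinn[OF that] by (simp add: h_def cos_squared_eq)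
    then show ?thesis by (simp add: abs_square_less_1)
  qed

  \<comment> \<open>The flow in terms of \<open>\<bar>q\<bar>\<close> and the angle\<close>
  define B where "B t = arccos (- (e * k * h t))" for t
  have x_lt: "- 1 < - (e * k * h t)" "- (e * k * h t) < 1" if "t \<in> T" for t
    using h_lt[OF that] k e by auto
  have B_rng: "0 < B t" "B t < pi" if "t \<in> T" for t
    using arccos_lt_bounded[OF x_lt[OF that]] by (auto simp: B_def)
  have cosB: "cos (B t) = - (e * k * h t)" if "t \<in> T" for t
    using x_lt[OF that] by (simp add: B_def)
  have sinB: "sin (B t) = sqrt (1 - (h t)\<^sup>2)" if "t \<in> T" for t
    using x_lt[OF that] k e by (auto simp: B_def sin_arccos)
  have hB: "h t = - (e * k * cos (B t))" if "t \<in> T" for t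
    using cosB[OF that] k e by auto
  have sinB_pos: "0 < sin (B t)" if "t \<in> T" for t
    using B_rng[OF that] by (intro sin_gt_zero)

  have a_deriv: "((\<lambda>t. \<bar>q t\<bar>) has_real_derivative
      k * (\<bar>q t\<bar> * (compl_E \<bar>q t\<bar> + \<bar>q t\<bar> * compl_K \<bar>q t\<bar> * cos (B t)))) (at t within T)" if t: "t \<in> T" for t
  proof -
    have "((\<lambda>t. e * q t) has_real_derivative
        e * (q t * (compl_E \<bar>q t\<bar> * k - q t * compl_K \<bar>q t\<bar> * h t))) (at t within T)"
      by (rule DERIV_cmult[OF q_deriv[OF t]])
    then have "((\<lambda>t. \<bar>q t\<bar>) has_real_derivative
        e * (q t * (compl_E \<bar>q t\<bar> * k - q t * compl_K \<bar>q t\<bar> * h t))) (at t within T)"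
      by (rule has_field_derivative_transform_within[of _ _ _ _ 1]) (use t qe in auto)
    moreover have "e * (q t * (compl_E \<bar>q t\<bar> * k - q t * compl_K \<bar>q t\<bar> * h t))
       = k * (\<bar>q t\<bar> * (compl_E \<bar>q t\<bar> + \<bar>q t\<bar> * compl_K \<bar>q t\<bar> * cos (B t)))"
    proof -
      define A E K where "A = \<bar>q t\<bar>" and "E = compl_E \<bar>q t\<bar>" and "K = compl_K \<bar>q t\<bar>"
      have "q t = e * A" using qe[OF t] by (simp add: A_def)
      moreover have "e * (e * A * (E * k - e * A * K * h t)) = k * (A * (E + A * K * - (e * k * h t)))"
        using kk by algebra
      ultimately show ?thesis unfolding cosB[OF t] A_def E_def K_def by simp
    qed
    ultimately show ?thesis by simp
  qed
  have b_deriv: "(B has_real_derivative - k * (\<bar>q t\<bar> * sin (B t) * compl_Q \<bar>q t\<bar>)) (at t within T)" if t: "t \<in> T" for t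
  proof -
    define A Q r where "A = \<bar>q t\<bar>" and "Q = compl_Q \<bar>q t\<bar>" and "r = sqrt (1 - (h t)\<^sup>2)"
    have r: "r > 0" "r\<^sup>2 = 1 - (h t)\<^sup>2"
      using sinB[OF t] sinB_pos[OF t] sinn[OF t] by (auto simp: r_def h_def cos_squared_eq)
    have "(1 - (e * k * h t)\<^sup>2) = r\<^sup>2" using k e r by auto
    then have *: "inverse (- sqrt (1 - (- (e * k * h t))\<^sup>2)) = - (1 / r)" using r(1) by (simp add: divide_inverse)
    have "q t * ((1 - (h t)\<^sup>2) / (1 - (q t)\<^sup>2)) * (2 * compl_E \<bar>q t\<bar> - (1 + (q t)\<^sup>2) * compl_K \<bar>q t\<bar>)
        = - (e * A * r\<^sup>2 * Q)"
    proof -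
      have gen: "x * (R / d) * (y - z) = - (x * R * ((z - y) / d))" for x R d y z :: real
        by (simp add: algebra_simps diff_divide_distrib)
      have "Q = ((1 + (q t)\<^sup>2) * compl_K \<bar>q t\<bar> - 2 * compl_E \<bar>q t\<bar>) / (1 - (q t)\<^sup>2)"
        by (simp add: Q_def compl_Q_def)
      moreover have "e * A = q t" using qe(1)[OF t] by (simp add: A_def)
      ultimately show ?thesis unfolding r(2) gen by (simp only:)
    qed
    then have "((\<lambda>t. - (e * k * h t)) has_real_derivative - (e * k * - (e * A * r\<^sup>2 * Q))) (at t within T)"
      using DERIV_minus[OF DERIV_cmult[OF h_deriv[OF t], of "e * k"]] by simp
    from DERIV_chain2[OF DERIV_arccos[OF x_lt[OF t]] this]
    have "(B has_real_derivative - (1 / r) * - (e * k * - (e * A * r\<^sup>2 * Q))) (at t within T)"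
      unfolding B_def[abs_def] * .
    moreover have "- (1 / r) * - (e * k * - (e * A * r\<^sup>2 * Q)) = - k * (A * r * Q)"
      using r(1) e by (auto simp: power2_eq_square)
    ultimately show ?thesis by (simp add: A_def Q_def r_def sinB[OF t])
  qed

  \<comment> \<open>The change of time\<close>
  \<comment> \<open>The factor \<open>k\<close> orients time so that \<open>a\<close> has negative
    derivative at the flat torus.\<close>
  define S where "S = (\<lambda>t. k * (t0 - t)) ` T"
  have kk_mult: "k * (k * x) = x" for x
    by (simp add: mult.assoc [symmetric] kk)
  have S_iff: "u \<in> S \<longleftrightarrow> t0 - k * u \<in> T" for u
  proof
    show "u \<in> S \<Longrightarrow> t0 - k * u \<in> T" by (auto simp: S_def kk_mult)
    show "t0 - k * u \<in> T \<Longrightarrow> u \<in> S"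
      unfolding S_def by (rule image_eqI[of _ _ "t0 - k * u"]) (simp_all add: kk_mult)
  qed
  have T_eq: "(\<lambda>u. t0 - k * u) ` S = T"
    by (simp add: S_def image_image kk_mult)
  define a where "a u = \<bar>q (t0 - k * u)\<bar>" for u
  define b where "b u = B (t0 - k * u)" for u
  have inner: "((\<lambda>u. t0 - k * u) has_real_derivative - k) (at u within S)" for u
    by (auto intro!: derivative_eq_intros)
  interpret rf: revolution_flow S a b
  proof
    show "is_interval S"
      unfolding is_interval_connected_1 S_def
      by (intro connected_continuous_image connT continuous_intros)
    show "0 \<in> S" using T(2) by (simp add: S_iff)
    show "a ` S = {0<..1}"
      unfolding q_image [symmetric] a_def T_eq [symmetric] by (simp add: image_image)
    fix u assume u: "u \<in> S"
    then have t: "t0 - k * u \<in> T" by (simp add: S_iff)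
    show "a u = 1 \<longleftrightarrow> u = 0"
    proof (cases "u = 0")
      case False
      then have "t0 - k * u \<in> T - {t0}" using t k by auto
      then show ?thesis using q1 False by (fastforce simp: a_def)
    qed (simp add: a_def q_t0)
    show "0 < b u \<and> b u < pi" using B_rng[OF t] by (simp add: b_def)
    have "((\<lambda>t. \<bar>q t\<bar>) \<circ> (\<lambda>u. t0 - k * u) has_real_derivative
       k * (a u * (compl_E (a u) + a u * compl_K (a u) * cos (b u))) * - k) (at u within S)"
      using a_deriv[OF t] by (intro DERIV_image_chain inner) (simp add: T_eq a_def b_def)
    then show "(a has_real_derivative - (a u * (compl_E (a u) + a u * compl_K (a u) * cos (b u)))) (at u within S)"
      using k by (auto simp: a_def[abs_def] o_def)
    have "(B \<circ> (\<lambda>u. t0 - k * u) has_real_derivative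
       - k * (a u * sin (b u) * compl_Q (a u)) * - k) (at u within S)"
      using b_deriv[OF t] by (intro DERIV_image_chain inner) (simp add: T_eq a_def b_def)
    then show "(b has_real_derivative a u * sin (b u) * compl_Q (a u)) (at u within S)"
      using k by (auto simp: b_def[abs_def] o_def)
  qed
  \<comment> \<open>\<open>S_nonneg\<close> puts \<open>T\<close> on one side of \<open>t0\<close>,
    the side fixed by \<open>k\<close>; so the new time is the distance to
    \<open>t0\<close>.\<close>
  have dist: "\<bar>t - t0\<bar> = k * (t0 - t)" if "t \<in> T" for t
  proof -
    have "k * (t0 - t) \<in> S" using that by (auto simp: S_def)
    with rf.S_nonneg[OF this] k show ?thesis by auto
  qed
  have unfold_dist: "t0 - k * \<bar>t - t0\<bar> = t" if "t \<in> T" for t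
    by (simp add: dist[OF that] kk_mult)
  show thesis
  proof (rule that)
    show "revolution_flow S a b" by unfold_locales
    show "k \<in> {1, -1}" by (rule k)
    show "u \<in> S \<longleftrightarrow> t0 - k * u \<in> T" for u by (rule S_iff)
    show "\<bar>t - t0\<bar> = k * (t0 - t)" if "t \<in> T" for t by (rule dist[OF that])
    show "a \<bar>t - t0\<bar> = \<bar>q t\<bar>" if "t \<in> T" for t using unfold_dist[OF that] by (simp add: a_def)
    have "e = q t0" using q_t0 by (auto simp: e_def sgn_if)
    then show "cos (b 0) = 1 - 2 * \<rho>\<^sup>2"
      using flat_triple_angle[OF ft k2[OF T(2)] _ _ \<rho>] l cosB[OF T(2)] by (simp add: b_def k_def h_def)
    \<comment> \<open>\<open>\<sigma>\<close> comes from the normal, \<open>- (e * k)\<close> from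
      the definition of \<open>B\<close>, and \<open>s\<close> from the fact that
      \<open>sin (B t)\<close> is positive.\<close>
    show "- (\<sigma> * e * k * s) \<in> {1, -1}" using \<sigma> e k s by auto
    show "mean_curvature (f t) (N t) p = - (\<sigma> * e * k * s) * cot (b \<bar>t - t0\<bar>)" if t: "t \<in> T" for t p
    proof -
      have "\<bar>sin (\<theta>1 t - \<theta>2 t)\<bar> = sin (B t)"
        unfolding sinB[OF t] h_def by (simp add: cos_squared_eq)
      then have "sin (\<theta>1 t - \<theta>2 t) = s * sin (B t)"
        using s_const[OF t] sgn_mult_abs[of "sin (\<theta>1 t - \<theta>2 t)"] by simp
      moreover have "cos (\<theta>1 t - \<theta>2 t) = - (e * k * cos (B t))"
        using hB[OF t] by (simp add: h_def)
      ultimately have "cot (\<theta>1 t - \<theta>2 t) = - (e * k * s) * cot (B t)"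
        using s by (auto simp: cot_def)
      with mean_curvature_equivariant_cmc[OF cmc[OF t] \<sigma>, of p] unfold_dist[OF t] show ?thesis
        by (simp add: b_def)
    qed
  qed
qed

theorem lemma5p9:
  fixes l0 l2 :: int and \<rho> t0 :: real and T :: "real set"
    and q \<theta>1 \<theta>2 :: "real \<Rightarrow> real"
    and f N :: "real \<Rightarrow> real \<times> real \<Rightarrow> real^4"
  assumes "coprime l0 l2" and "0 < l0" and "l0 < l2"
    and "\<rho> = real_of_int l0 / real_of_int l2"
    and "revolution_family l0 l2 T t0 q \<theta>1 \<theta>2 f N"
  shows "(\<exists>H :: real \<Rightarrow> real.
           (\<forall>t\<in>T. \<forall>p. mean_curvature (f t) (N t) p = H t) \<and>
           H t0 = (1 - 2 * \<rho>\<^sup>2) / (2 * \<rho> * sqrt (1 - \<rho>\<^sup>2)) \<and>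
           (\<forall>s\<in>T. \<forall>t\<in>T. \<bar>s - t0\<bar> < \<bar>t - t0\<bar> \<longrightarrow> H t < H s) \<and>
           (H \<longlongrightarrow> cot (pi * \<rho>)) (inf (filtercomap q (at 0)) (principal T))) \<and>
         (if 1 / 2 < \<rho> \<and> \<rho> \<le> 1 / sqrt 2
         then \<exists>!t. t \<in> T \<and> minimal_torus (f t) (N t)
         else \<not> (\<exists>t\<in>T. minimal_torus (f t) (N t)))"
proof -
  obtain S a b k c where "revolution_flow S a b" and k: "k \<in> {1, -1::real}"
    and S_iff: "\<And>u. u \<in> S \<longleftrightarrow> t0 - k * u \<in> T"
    and dist: "\<And>t. t \<in> T \<Longrightarrow> \<bar>t - t0\<bar> = k * (t0 - t)"
    and a_q: "\<And>t. t \<in> T \<Longrightarrow> a \<bar>t - t0\<bar> = \<bar>q t\<bar>"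
    and b0: "cos (b 0) = 1 - 2 * \<rho>\<^sup>2"
    and c: "c \<in> {1, -1}"
    and mc: "\<And>t p. t \<in> T \<Longrightarrow> mean_curvature (f t) (N t) p = c * cot (b \<bar>t - t0\<bar>)"
    using revolution_family_reduced_flow[OF assms(5,2,3,4)] by blast
  interpret revolution_flow S a b by fact
  have TS: "\<bar>t - t0\<bar> \<in> S" if "t \<in> T" for t
    using dist[OF that] k that by (auto simp: S_iff)
  have t0: "t0 \<in> T" and tori: "\<And>t. t \<in> T \<Longrightarrow> torus (f t)"
    using assms(5) by (auto simp: revolution_family_def)
  have \<rho>: "0 < \<rho>" "\<rho> < 1" using assms(2,3) by (auto simp: assms(4))
  have \<rho>_sqrt: "\<rho> \<le> 1 / sqrt 2 \<longleftrightarrow> 2 * \<rho>\<^sup>2 \<le> 1" "\<rho> < 1 / sqrt 2 \<longleftrightarrow> 2 * \<rho>\<^sup>2 < 1"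
  proof -
    have "\<rho> = sqrt (\<rho>\<^sup>2)" "1 / sqrt 2 = sqrt (1 / 2)"
      using \<rho>(1) by (simp_all add: real_sqrt_divide)
    then have "\<rho> \<le> 1 / sqrt 2 \<longleftrightarrow> \<rho>\<^sup>2 \<le> 1 / 2" "\<rho> < 1 / sqrt 2 \<longleftrightarrow> \<rho>\<^sup>2 < 1 / 2"
      by (metis real_sqrt_le_iff, metis real_sqrt_less_iff)
    then show "\<rho> \<le> 1 / sqrt 2 \<longleftrightarrow> 2 * \<rho>\<^sup>2 \<le> 1" "\<rho> < 1 / sqrt 2 \<longleftrightarrow> 2 * \<rho>\<^sup>2 < 1" by auto
  qed
  \<comment> \<open>The choice of normal is left open at \<open>\<rho> = 1 / sqrt 2\<close>, which does not occur.\<close>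
  have \<rho>_ne: "2 * \<rho>\<^sup>2 \<noteq> 1"
  proof
    assume "2 * \<rho>\<^sup>2 = 1"
    then have "2 * (real_of_int l0)\<^sup>2 = (real_of_int l2)\<^sup>2"
      using assms(2,3) by (simp add: assms(4) power_divide field_simps)
    then have "real_of_int (2 * l0\<^sup>2) = real_of_int (l2\<^sup>2)" by simp
    then show False using two_square_ne_square[OF assms(1)] of_int_eq_iff by blast
  qed

  \<comment> \<open>The flat torus and the choice of normal\<close>
  \<comment> \<open>Half-angle formula; \<open>b 0 / 2\<close> lies in the first quadrant, which
    selects the positive root.\<close>
  have b0_half: "sin (b 0 / 2) = \<rho>"
  proof -
    have "1 - 2 * (sin (b 0 / 2))\<^sup>2 = 1 - 2 * \<rho>\<^sup>2"
      using b0 cos_double_sin[of "b 0 / 2"] by simp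
    moreover have "0 < sin (b 0 / 2)" using b_rng[OF S(2)] by (intro sin_gt_zero) auto
    ultimately show ?thesis using \<rho>(1) by (simp add: power2_eq_iff_nonneg)
  qed
  have cot_b0: "cot (b 0) = (1 - 2 * \<rho>\<^sup>2) / (2 * \<rho> * sqrt (1 - \<rho>\<^sup>2))"
  proof -
    have "cos (b 0 / 2) = sqrt (1 - \<rho>\<^sup>2)"
      using b_rng[OF S(2)] by (intro real_sqrt_unique [symmetric])
        (auto simp: cos_squared_eq b0_half intro!: cos_ge_zero)
    then have "sin (b 0) = 2 * \<rho> * sqrt (1 - \<rho>\<^sup>2)"
      using sin_double[of "b 0 / 2"] b0_half by simp
    with b0 show ?thesis by (simp add: cot_def)
  qed
  have "\<rho>\<^sup>2 < 1" using \<rho> by (simp add: power_less_one_iff)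
  then have den: "0 < 2 * \<rho> * sqrt (1 - \<rho>\<^sup>2)" using \<rho>(1) by simp
  have sign: "0 < \<rho> \<and> \<rho> < 1 / sqrt 2 \<longrightarrow> mean_curvature (f t0) (N t0) p > 0"
    "1 / sqrt 2 < \<rho> \<and> \<rho> < 1 \<longrightarrow> mean_curvature (f t0) (N t0) p < 0" for p
    using assms(5) unfolding revolution_family_def Let_def assms(4) by blast+
  \<comment> \<open>In both ranges of \<rho> the sign convention agrees with the sign of
    \<open>cot (b 0)\<close>, which rules out \<open>c = -1\<close>.\<close>
  have "c = 1"
  proof (cases "2 * \<rho>\<^sup>2 < 1")
    case True
    then have "mean_curvature (f t0) (N t0) 0 > 0"
      using sign(1) \<rho>(1) \<rho>_sqrt by blast
    moreover have "cot (b 0) > 0" unfolding cot_b0 using True den by simp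
    ultimately show ?thesis using mc[OF t0, of 0] c by auto
  next
    case False
    then have "1 / sqrt 2 < \<rho>" using \<rho>_sqrt \<rho>_ne by auto
    then have "mean_curvature (f t0) (N t0) 0 < 0"
      using sign(2) \<rho>(2) by blast
    moreover have "cot (b 0) < 0" unfolding cot_b0 using False \<rho>_ne den by (simp add: divide_neg_pos)
    ultimately show ?thesis using mc[OF t0, of 0] c by auto
  qed
  then have mc: "mean_curvature (f t) (N t) p = cot (b \<bar>t - t0\<bar>)" if "t \<in> T" for t p
    using mc[OF that] by simp

  have min_iff: "minimal_torus (f t) (N t) \<longleftrightarrow> b \<bar>t - t0\<bar> = pi / 2" if t: "t \<in> T" for t
  proof -
    have r: "0 < b \<bar>t - t0\<bar>" "b \<bar>t - t0\<bar> < pi" using b_rng[OF TS[OF t]] by auto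
    have "minimal_torus (f t) (N t) \<longleftrightarrow> cot (b \<bar>t - t0\<bar>) = 0"
      using tori[OF t] mc[OF t] by (simp add: minimal_torus_def)
    also have "\<dots> \<longleftrightarrow> b \<bar>t - t0\<bar> = pi / 2"
    proof
      assume "cot (b \<bar>t - t0\<bar>) = 0"
      then show "b \<bar>t - t0\<bar> = pi / 2"
        using r cot_less[of "b \<bar>t - t0\<bar>" "pi / 2"] cot_less[of "pi / 2" "b \<bar>t - t0\<bar>"]
        by (force simp: cot_def)
    qed (simp only: cot_def cos_pi_half div_0)
    finally show ?thesis .
  qed

  \<comment> \<open>Limit and monotonicity of the mean curvature\<close>
  have limit: "((\<lambda>t. cot (b \<bar>t - t0\<bar>)) \<longlongrightarrow> cot (pi * \<rho>)) (inf (filtercomap q (at 0)) (principal T))"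
    (is "(_ \<longlongrightarrow> _) ?F")
  proof (rule tendsto_cot)
    have evT: "eventually (\<lambda>t. t \<in> T) ?F" by (simp add: eventually_inf_principal)
    have "filterlim q (at 0) ?F"
      by (rule filterlim_mono[OF filterlim_filtercomap order_refl inf_le1])
    then have "(q \<longlongrightarrow> 0) ?F" by (simp add: filterlim_at)
    then have "((\<lambda>t. \<bar>q t\<bar>) \<longlongrightarrow> 0) ?F" by (rule tendsto_rabs_zero)
    then have "((\<lambda>t. a \<bar>t - t0\<bar>) \<longlongrightarrow> 0) ?F"
      by (rule Lim_transform_eventually) (use evT a_q in \<open>auto elim!: eventually_mono\<close>)
    moreover have "filterlim (\<lambda>t. \<bar>t - t0\<bar>) (principal S) ?F"
      unfolding filterlim_principal using evT by eventually_elim (rule TS)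
    ultimately show "((\<lambda>t. b \<bar>t - t0\<bar>) \<longlongrightarrow> pi * \<rho>) ?F"
      using b_tendsto by (simp add: b0_half)
    have "sin (pi * \<rho>) > 0" using \<rho> by (intro sin_gt_zero) auto
    then show "sin (pi * \<rho>) \<noteq> 0" by simp
  qed

  have mono: "cot (b \<bar>t - t0\<bar>) < cot (b \<bar>s - t0\<bar>)" if "s \<in> T" "t \<in> T" "\<bar>s - t0\<bar> < \<bar>t - t0\<bar>" for s t
    using that b_rng TS b_strict_mono by (intro cot_less) auto

  \<comment> \<open>Counting the minimal tori\<close>
  have torus_count: "if 1 / 2 < \<rho> \<and> \<rho> \<le> 1 / sqrt 2
         then \<exists>!t. t \<in> T \<and> minimal_torus (f t) (N t)
         else \<not> (\<exists>t\<in>T. minimal_torus (f t) (N t))"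
  proof (cases "1 / 2 < \<rho> \<and> \<rho> \<le> 1 / sqrt 2")
    case True
    \<comment> \<open>\<open>b\<close> starts at or below \<open>pi / 2\<close> since
      \<open>2 * \<rho>\<^sup>2 \<le> 1\<close>, and comes arbitrarily close to
      \<open>pi * \<rho> > pi / 2\<close>, so it passes through \<open>pi / 2\<close>.\<close>
    have "pi / 2 < pi * sin (b 0 / 2)" using True by (simp add: b0_half)
    then obtain u where u: "u \<in> S" "pi / 2 < b u" using b_approx by blast
    have "cos (b 0) \<ge> 0" using True \<rho>_sqrt by (simp add: b0)
    then have b0_le: "b 0 \<le> pi / 2"
      using b_rng[OF S(2)] cos_monotone_0_pi[of "pi / 2" "b 0"] by force
    have "\<exists>x. 0 \<le> x \<and> x \<le> u \<and> b x = pi / 2"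
    proof (rule IVT')
      show "continuous_on {0..u} b"
        by (rule continuous_on_subset[OF b_cont]) (use between[OF u(1)] in auto)
    qed (use u b0_le S_nonneg in auto)
    then obtain x where x: "0 \<le> x" "x \<le> u" "b x = pi / 2" by blast
    have "x \<in> S" using between u x by blast
    then have "t0 - k * x \<in> T" "\<bar>(t0 - k * x) - t0\<bar> = x" using k x(1) by (auto simp: S_iff)
    then have "t0 - k * x \<in> T \<and> minimal_torus (f (t0 - k * x)) (N (t0 - k * x))"
      using min_iff x(3) by simp
    \<comment> \<open>Strict monotonicity of \<open>b\<close> determines the distance to
      \<open>t0\<close>, and the orientation \<open>k\<close> then determines the time
      itself.\<close>
    moreover have "s = t" if "s \<in> T" "t \<in> T" "minimal_torus (f s) (N s)" "minimal_torus (f t) (N t)" for s t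
    proof -
      have "b \<bar>s - t0\<bar> = b \<bar>t - t0\<bar>" using that min_iff by simp
      then have "\<bar>s - t0\<bar> = \<bar>t - t0\<bar>"
        using b_strict_mono[OF TS[OF that(1)] TS[OF that(2)]] b_strict_mono[OF TS[OF that(2)] TS[OF that(1)]]
        by (cases "\<bar>s - t0\<bar>" "\<bar>t - t0\<bar>" rule: linorder_cases) auto
      then show ?thesis using dist that(1,2) k by auto
    qed
    ultimately show ?thesis unfolding if_P[OF True] by blast
  next
    case False
    have "\<not> minimal_torus (f t) (N t)" if t: "t \<in> T" for t
    proof (cases "\<rho> \<le> 1 / 2")
      case True
      \<comment> \<open>Strictness of \<open>b < pi * \<rho>\<close> settles
        \<open>\<rho> = 1 / 2\<close>, where mean curvature 0 is only the limit at the
        bouquet.\<close>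
      then have "b \<bar>t - t0\<bar> < pi / 2"
        using b_less[OF TS[OF t]] mult_left_mono[OF True pi_ge_zero] unfolding b0_half by linarith
      then show ?thesis using min_iff[OF t] by simp
    next
      case False
      with \<open>\<not> (1 / 2 < \<rho> \<and> \<rho> \<le> 1 / sqrt 2)\<close> have "cos (b 0) < 0" using \<rho>_sqrt by (simp add: b0)
      \<comment> \<open>Beyond \<open>1 / sqrt 2\<close> the family already starts past
        \<open>pi / 2\<close>, and \<open>b\<close> only grows.\<close>
      then have "pi / 2 < b 0"
        using b_rng[OF S(2)] cos_ge_zero[of "b 0"] by force
      also have "b 0 \<le> b \<bar>t - t0\<bar>"
        using b_strict_mono[OF S(2) TS[OF t]] by (cases "t = t0") auto
      finally show ?thesis using min_iff[OF t] by simp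
    qed
    then show ?thesis unfolding if_not_P[OF False] by blast
  qed

  show ?thesis
    using mc cot_b0 mono limit torus_count by (intro conjI exI[of _ "\<lambda>t. cot (b \<bar>t - t0\<bar>)"]) auto
qed

end
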